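(* Let $F$ be a PCA with alphabet $\{0,1\}$, neighborhood $\{0,1\}$ and parameters $\theta_{00},\theta_{01},\theta_{10},\theta_{11}\in[0,1]$, and let $p\in(0,1)$ be such that $$(1-p)\theta_{00}+p\,\theta_{10}=(1-p)\theta_{01}+p\,\theta_{11}=p$$ (so that $\mu_p$ is invariant for $F$). Let $(X^n_k)_{k,n\in\mathbb Z}$ be the stationary space-time diagram of $F$ associated with $\mu_p$. Then: \begin{enumerate} \item The lines of angle $2\pi/3$ of the space-time diagram are distributed according to $\mu_p$: for every $c\in\mathbb Z$, the variables $(X^n_{c-n})_{n\in\mathbb Z}$ are i.i.d. Bernoulli of parameter $p$. \item The correlations of these lines are those of a transversal PCA of direction $\vec w$ with parameters $\vartheta_{00}=\theta_{00}$, $\vartheta_{11}=\theta_{11}$, $\vartheta_{01}=\theta_{10}$, $\vartheta_{10}=\theta_{01}$. That is, the random field $(Z^m_j)_{j,m\in\mathbb Z}$ defined by $Z^m_j=X^{j}_{-m-j}$ has the law of the stationary space-time diagram, associated with $\mu_p$, of the PCA with neighborhood $\{0,1\}$ and parameters $\vartheta_{xy}$; in particular, given the line $(X^{n}_{c+1-n})_{n\in\mathbb Z}$, the variables $(X^n_{c-n})_{n\in\mathbb Z}$ are independent and $X^n_{c-n}$ equals $1$ with probability $\vartheta_{xy}$ where $x=X^n_{c-n+1}$ and $y=X^{n+1}_{c-n}$. \end{enumerate}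
   Context: A PCA with alphabet $\{0,1\}$ and neighborhood $\{0,1\}$ is determined by four parameters $\theta_{xy}\in[0,1]$: the new value of cell $k\in\mathbb Z$ equals $1$ with probability $\theta_{xy}$ when the current values of cells $k$ and $k+1$ are $x$ and $y$, independently for different cells. $\mu_p$ denotes the Bernoulli product measure on $\{0,1\}^{\mathbb Z}$ in which each coordinate equals $1$ with probability $p$. When $\mu_p$ is invariant, the stationary space-time diagram associated with $\mu_p$ is the random field $(X^n_k)_{k,n\in\mathbb Z}$ ($k$ is the space coordinate, $n$ the time coordinate) such that, for every $n\in\mathbb Z$, $X^n=(X^n_k)_{k\in\mathbb Z}\sim\mu_p$ and, given $(X^m)_{m\le n}$, the variables $(X^{n+1}_k)_{k\in\mathbb Z}$ are independent with $\mathbb P(X^{n+1}_k=1\mid (X^m)_{m\le n})=\theta_{X^n_kX^n_{k+1}}$. The diagram is drawn on the triangular lattice, $X^n_k$ being placed at the point $(k+n/2,\sqrt3\,n/2)$; lines of angle $2\pi/3$ are thus those on which $k+n$ is constant. A transversal PCA of direction $\vec w$ exists when the diagram, rotated by $-2\pi/3$, has the law of a space-time diagram generated by a PCA of neighborhood $\{0,1\}$; in it, $X_{k}^n$ is updated from the left neighbor $X_{k+1}^{n}$ and the right neighbor $X_k^{n+1}$. *)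

theory Defs
  imports "HOL-Probability.Probability"
begin

text \<open>
  The alphabet \<open>{0,1}\<close> is \<^typ>\<open>bool\<close>, with \<^term>\<open>True\<close> for \<open>1\<close>.  A PCA of neighborhood \<open>{0,1}\<close> is
  given by \<open>\<theta> :: bool \<Rightarrow> bool \<Rightarrow> real\<close>; \<open>\<theta> x y\<close> is the probability of the new value \<open>1\<close> at cell \<open>k\<close>
  when cells \<open>k\<close> and \<open>k + 1\<close> carry \<open>x\<close> and \<open>y\<close>.  Random fields are written \<open>X n k\<close>, with the time
  coordinate first and the space coordinate second.
\<close>

definition bernoulli_field :: "real \<Rightarrow> (int \<Rightarrow> bool) measure"
  where "bernoulli_field p = PiM UNIV (\<lambda>_. measure_pmf (bernoulli_pmf p))"

definition pca_kernel :: "(bool \<Rightarrow> bool \<Rightarrow> real) \<Rightarrow> (int \<Rightarrow> bool) \<Rightarrow> (int \<Rightarrow> bool) measure"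
  where "pca_kernel \<theta> x = PiM UNIV (\<lambda>k. measure_pmf (bernoulli_pmf (\<theta> (x k) (x (k + 1)))))"

definition pca_invariant :: "(bool \<Rightarrow> bool \<Rightarrow> real) \<Rightarrow> (int \<Rightarrow> bool) measure \<Rightarrow> bool"
  where "pca_invariant \<theta> \<mu> \<longleftrightarrow> bind \<mu> (pca_kernel \<theta>) = \<mu>"

text \<open>The \<open>\<sigma>\<close>-algebra on \<^term>\<open>space M\<close> generated by a family of binary random variables.\<close>

definition generated_algebra :: "'a measure \<Rightarrow> 'i set \<Rightarrow> ('i \<Rightarrow> 'a \<Rightarrow> bool) \<Rightarrow> 'a measure"
  where "generated_algebra M I Y = sigma (space M) (\<Union>i\<in>I. range (\<lambda>B. Y i -` B \<inter> space M))"

definition cprob :: "'a measure \<Rightarrow> 'a measure \<Rightarrow> ('a \<Rightarrow> bool) \<Rightarrow> 'a \<Rightarrow> real"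
  where "cprob M G P = real_cond_exp M G (indicator {\<omega> \<in> space M. P \<omega>})"

definition cond_indep_vars ::
    "'a measure \<Rightarrow> 'a measure \<Rightarrow> ('i \<Rightarrow> 'a \<Rightarrow> bool) \<Rightarrow> 'i set \<Rightarrow> bool"
  where "cond_indep_vars M G Y I \<longleftrightarrow>
    (\<forall>J B. finite J \<longrightarrow> J \<subseteq> I \<longrightarrow>
      (AE \<omega> in M. cprob M G (\<lambda>\<omega>'. \<forall>j\<in>J. Y j \<omega>' \<in> B j) \<omega>
                  = (\<Prod>j\<in>J. cprob M G (\<lambda>\<omega>'. Y j \<omega>' \<in> B j) \<omega>)))"

definition stationary_diagram ::
    "(bool \<Rightarrow> bool \<Rightarrow> real) \<Rightarrow> real \<Rightarrow> 'a measure \<Rightarrow> (int \<Rightarrow> int \<Rightarrow> 'a \<Rightarrow> bool) \<Rightarrow> bool"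
  where "stationary_diagram \<theta> p M X \<longleftrightarrow>
    prob_space M \<and>
    (\<forall>n k. X n k \<in> measurable M (count_space UNIV)) \<and>
    (\<forall>n. distr M (PiM UNIV (\<lambda>_. count_space UNIV)) (\<lambda>\<omega> k. X n k \<omega>) = bernoulli_field p) \<and>
    (\<forall>n. let past = generated_algebra M ({..n} \<times> UNIV) (\<lambda>(m, k). X m k) in
      cond_indep_vars M past (X (n + 1)) UNIV \<and>
      (\<forall>k. AE \<omega> in M. cprob M past (X (n + 1) k) \<omega> = \<theta> (X n k \<omega>) (X n (k + 1) \<omega>)))"

definition field_law :: "'a measure \<Rightarrow> (int \<Rightarrow> int \<Rightarrow> 'a \<Rightarrow> bool) \<Rightarrow> (int \<times> int \<Rightarrow> bool) measure"
  where "field_law M X = distr M (PiM UNIV (\<lambda>_. count_space UNIV)) (\<lambda>\<omega> (n, k). X n k \<omega>)"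

end

theory Submission
  imports Defs
begin

text \<open>
  Write \<open>\<mu> u\<close> for the Bernoulli weight of a bit \<open>u\<close>, and \<open>\<theta>(u, x; y)\<close> for the probability that a
  cell with parents \<open>u\<close> (left) and \<open>x\<close> (right) takes the value \<open>y\<close>.  The two hypotheses on \<open>\<theta>\<close>
  say that, for every value of the right parent, a Bernoulli left parent produces a Bernoulli
  child: \<open>\<Sum>\<^sub>u \<mu> u \<cdot> \<theta>(u, x; y) = \<mu> y\<close>.  For bits this is the same as the reversal identity
  \<open>\<mu> u \<cdot> \<theta>(u, x; y) = \<mu> y \<cdot> \<phi>(x, y; u)\<close>, where \<open>\<phi> x y = \<theta> y x\<close> (\<open>bernoulli_rule_balance\<close>): the left
  parent can be traded for the child, and it is then updated from the right parent and the
  child.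

  In a stationary diagram, the probability of a configuration on the triangle
  \<open>n \<ge> a, k \<ge> b, n + k \<le> c\<close> is the product of the weights \<open>\<mu>\<close> along the row \<open>n = a\<close> and of one factor
  \<open>\<theta>\<close> for each other site (\<open>stationary_diagram_triangle_law\<close>).  Apply the reversal identity to
  these factors, one column \<open>k = const\<close> at a time and from the bottom up: the factor \<open>\<mu>\<close> of a
  column moves from its lowest site to its highest one, and every \<open>\<theta>\<close> becomes a \<open>\<phi>\<close>.  What remains
  is the product of the weights \<open>\<mu>\<close> along the line \<open>n + k = c\<close> and of one factor \<open>\<phi>\<close> for each other
  site, that is, the weight of the same triangle for the turned field and the rule \<open>\<phi>\<close>
  (\<open>region_weight_rotate\<close>).

  Every finite set of sites lies in a triangle, so that the triangle weights determine the law of a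
  field (\<open>triangle_law_unique\<close>).  They also make it a stationary diagram
  (\<open>triangle_law_stationary_diagram\<close>): summing over the topmost sites removes one factor after the
  other (\<open>region_law_marginal\<close>), which leaves the Bernoulli law on each row and the product of the
  one-step probabilities for a new row given the past.  Hence the turned field is a stationary
  diagram of \<open>\<phi>\<close>, and the lines \<open>n + k = c\<close> are its rows.

  Invariance of the Bernoulli measure is the same summation on two rows: given its right
  neighbour, the leftmost cell can be summed out by stationarity, then the next one, and so on
  (\<open>sum_chain_bernoulli\<close>).
\<close>

section \<open>Binary random fields and their atoms\<close>

lemma sets_binary_atom:
  fixes Y :: "'i \<Rightarrow> 'a \<Rightarrow> bool"
  assumes "finite J" "\<And>j. j \<in> J \<Longrightarrow> Y j \<in> measurable M (count_space UNIV)"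
  shows "{\<omega> \<in> space M. \<forall>j\<in>J. Y j \<omega> \<in> B j} \<in> sets M"
proof (rule sets.sets_Collect_finite_All[OF _ assms(1)])
  fix j assume "j \<in> J"
  then have "Y j -` B j \<inter> space M \<in> sets M"
    using assms(2) by (auto intro: measurable_sets)
  then show "{\<omega> \<in> space M. Y j \<omega> \<in> B j} \<in> sets M"
    by (auto simp: vimage_def Int_def conj_commute)
qed

text \<open>
  All laws below are computed on atoms, where every variable is prescribed.  This lemma passes from
  atoms to arbitrary constraints \<open>B j\<close>, inside a fixed event \<open>E\<close> that will describe the past.
\<close>

lemma (in finite_measure) measure_cylinder_eq_sum_atoms:
  fixes Y :: "'i \<Rightarrow> 'a \<Rightarrow> bool"
  assumes J: "finite J" and E: "E \<in> sets M"
    and Y: "\<And>j. j \<in> J \<Longrightarrow> Y j \<in> measurable M (count_space UNIV)"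
  shows "measure M (E \<inter> {\<omega> \<in> space M. \<forall>j\<in>J. Y j \<omega> \<in> B j})
    = (\<Sum>g\<in>PiE J B. measure M (E \<inter> {\<omega> \<in> space M. \<forall>j\<in>J. Y j \<omega> = g j}))"
proof -
  have fin: "finite (PiE J B)"
    using J by (intro finite_PiE) auto
  have "E \<inter> {\<omega> \<in> space M. \<forall>j\<in>J. Y j \<omega> \<in> B j}
      = (\<Union>g\<in>PiE J B. E \<inter> {\<omega> \<in> space M. \<forall>j\<in>J. Y j \<omega> = g j})" (is "?L = ?R")
  proof
    show "?L \<subseteq> ?R"
    proof
      fix \<omega> assume "\<omega> \<in> ?L"
      then have "(\<lambda>j\<in>J. Y j \<omega>) \<in> PiE J B \<and> \<omega> \<in> E \<inter> {\<omega> \<in> space M. \<forall>j\<in>J. Y j \<omega> = (\<lambda>j\<in>J. Y j \<omega>) j}"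
        by auto
      then show "\<omega> \<in> ?R" by blast
    qed
    show "?R \<subseteq> ?L" by (auto simp: PiE_iff)
  qed
  also have "measure M \<dots> = (\<Sum>g\<in>PiE J B. measure M (E \<inter> {\<omega> \<in> space M. \<forall>j\<in>J. Y j \<omega> = g j}))"
  proof (rule finite_measure_finite_Union[OF fin])
    have "{\<omega> \<in> space M. \<forall>j\<in>J. Y j \<omega> = g j} \<in> sets M" for g
      using sets_binary_atom[OF J Y, where B = "\<lambda>j. {g j}"] by simp
    then show "(\<lambda>g. E \<inter> {\<omega> \<in> space M. \<forall>j\<in>J. Y j \<omega> = g j}) ` PiE J B \<subseteq> sets M"
      using E by auto
    show "disjoint_family_on (\<lambda>g. E \<inter> {\<omega> \<in> space M. \<forall>j\<in>J. Y j \<omega> = g j}) (PiE J B)"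
      unfolding disjoint_family_on_def
    proof (intro ballI impI)
      fix g h assume g: "g \<in> PiE J B" and h: "h \<in> PiE J B" and "g \<noteq> h"
      then obtain j where "j \<in> J" "g j \<noteq> h j"
        using PiE_ext[OF g h] by blast
      then show "(E \<inter> {\<omega> \<in> space M. \<forall>j\<in>J. Y j \<omega> = g j})
          \<inter> (E \<inter> {\<omega> \<in> space M. \<forall>j\<in>J. Y j \<omega> = h j}) = {}"
        by auto
    qed
  qed
  finally show ?thesis .
qed

text \<open>
  A function of finitely many bits is a finite combination of indicators of atoms.
\<close>

lemma (in finite_measure) integral_finite_cylinder:
  fixes Y :: "'i \<Rightarrow> 'a \<Rightarrow> bool" and F :: "('i \<Rightarrow> bool) \<Rightarrow> real"
  assumes J: "finite J" and Y: "\<And>j. j \<in> J \<Longrightarrow> Y j \<in> measurable M (count_space UNIV)"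
    and cyl: "\<And>x y. (\<And>j. j \<in> J \<Longrightarrow> x j = y j) \<Longrightarrow> F x = F y"
  shows "integrable M (\<lambda>\<omega>. F (\<lambda>j. Y j \<omega>))"
    and "(\<integral>\<omega>. F (\<lambda>j. Y j \<omega>) \<partial>M)
      = (\<Sum>g\<in>PiE J (\<lambda>_. UNIV). F g * measure M {\<omega> \<in> space M. \<forall>j\<in>J. Y j \<omega> = g j})"
proof -
  let ?G = "PiE J (\<lambda>_. UNIV :: bool set)"
  let ?A = "\<lambda>g. {\<omega> \<in> space M. \<forall>j\<in>J. Y j \<omega> \<in> {g j}}"
  have fin: "finite ?G" using J by (intro finite_PiE) auto
  have A: "?A g \<in> sets M" for g using J Y by (intro sets_binary_atom) auto
  have F: "F (\<lambda>j. Y j \<omega>) = (\<Sum>g\<in>?G. F g * indicator (?A g) \<omega>)" if \<omega>: "\<omega> \<in> space M" for \<omega>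
  proof -
    define r where "r = (\<lambda>j\<in>J. Y j \<omega>)"
    have r: "r \<in> ?G" and r_eq: "\<And>j. j \<in> J \<Longrightarrow> r j = Y j \<omega>" by (simp_all add: r_def)
    have "F g * indicator (?A g) \<omega> = (if g = r then F g else 0)" if g: "g \<in> ?G" for g
    proof -
      have "\<omega> \<in> ?A g \<longleftrightarrow> (\<forall>j\<in>J. g j = r j)" using \<omega> r_eq by auto
      also have "\<dots> \<longleftrightarrow> g = r" using PiE_ext[OF g r] by blast
      finally show ?thesis by (simp add: indicator_def)
    qed
    then have "(\<Sum>g\<in>?G. F g * indicator (?A g) \<omega>) = (\<Sum>g\<in>?G. if g = r then F g else 0)"
      by (intro sum.cong refl)
    also have "\<dots> = F r" using fin r by (simp add: sum.delta)
    also have "\<dots> = F (\<lambda>j. Y j \<omega>)" by (rule cyl) (rule r_eq)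
    finally show ?thesis by simp
  qed
  have int: "integrable M (\<lambda>\<omega>. F g * indicator (?A g) \<omega>)" for g
    using A by (intro integrable_mult_right) (simp add: integrable_indicator_iff emeasure_eq_measure)
  then have "integrable M (\<lambda>\<omega>. \<Sum>g\<in>?G. F g * indicator (?A g) \<omega>)"
    by (rule Bochner_Integration.integrable_sum)
  then show "integrable M (\<lambda>\<omega>. F (\<lambda>j. Y j \<omega>))"
    by (subst Bochner_Integration.integrable_cong[OF refl F])
  have "(\<integral>\<omega>. F (\<lambda>j. Y j \<omega>) \<partial>M) = (\<integral>\<omega>. (\<Sum>g\<in>?G. F g * indicator (?A g) \<omega>) \<partial>M)"
    by (rule Bochner_Integration.integral_cong[OF refl F])
  also have "\<dots> = (\<Sum>g\<in>?G. \<integral>\<omega>. F g * indicator (?A g) \<omega> \<partial>M)"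
    by (rule Bochner_Integration.integral_sum[OF int])
  also have "\<dots> = (\<Sum>g\<in>?G. F g * measure M (?A g))"
  proof (rule sum.cong[OF refl])
    fix g
    have "?A g \<inter> space M = ?A g" by blast
    then show "(\<integral>\<omega>. F g * indicator (?A g) \<omega> \<partial>M) = F g * measure M (?A g)" by simp
  qed
  finally show "(\<integral>\<omega>. F (\<lambda>j. Y j \<omega>) \<partial>M)
      = (\<Sum>g\<in>?G. F g * measure M {\<omega> \<in> space M. \<forall>j\<in>J. Y j \<omega> = g j})"
    by (simp only: singleton_iff)
qed

text \<open>
  The atoms need not be known for every finite index set: a cofinal family of finite sets suffices,
  since a cylinder over \<open>F\<close> is a finite disjoint union of atoms over any larger finite set.  The
  cofinal families will be intervals, triangles and truncated triangles.
\<close>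

lemma measure_eqI_binary_atoms:
  fixes N1 N2 :: "('i \<Rightarrow> bool) measure"
  assumes N1: "sets N1 = sets (PiM I (\<lambda>_. count_space UNIV))"
    and N2: "sets N2 = sets (PiM I (\<lambda>_. count_space UNIV))"
    and fin1: "finite_measure N1" and fin2: "finite_measure N2"
    and cofinal: "\<And>F. finite F \<Longrightarrow> F \<subseteq> I \<Longrightarrow> \<exists>J. finite J \<and> F \<subseteq> J \<and> J \<subseteq> I \<and>
      (\<forall>\<sigma>. measure N1 {x \<in> space N1. \<forall>j\<in>J. x j = \<sigma> j}
          = measure N2 {x \<in> space N2. \<forall>j\<in>J. x j = \<sigma> j})"
  shows "N1 = N2"
proof (rule measure_eqI_PiM_infinite[OF N1 N2 _ fin1])
  let ?P = "PiM I (\<lambda>_. count_space UNIV) :: ('i \<Rightarrow> bool) measure"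
  interpret N1: finite_measure N1 by fact
  interpret N2: finite_measure N2 by fact
  have sp: "space N1 = space ?P" "space N2 = space ?P"
    using N1 N2 by (auto dest: sets_eq_imp_space_eq)
  fix F :: "'i set" and A :: "'i \<Rightarrow> bool set"
  assume F: "finite F" "F \<subseteq> I"
  obtain J where J: "finite J" "F \<subseteq> J" "J \<subseteq> I"
    and eq: "\<And>\<sigma>. measure N1 {x \<in> space N1. \<forall>j\<in>J. x j = \<sigma> j}
      = measure N2 {x \<in> space N2. \<forall>j\<in>J. x j = \<sigma> j}"
    using cofinal[OF F] by auto
  \<comment> \<open>The constraint on \<open>F\<close>, extended to the larger set \<open>J\<close> by trivial constraints.\<close>
  define C where "C j = (if j \<in> F then A j else UNIV)" for j
  have emb: "prod_emb I (\<lambda>_. count_space UNIV) F (PiE F A)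
      = space ?P \<inter> {x \<in> space ?P. \<forall>j\<in>J. x j \<in> C j}"
    using J F by (auto simp: prod_emb_def space_PiM C_def PiE_iff subset_iff)
  have m1: "(\<lambda>x. x j) \<in> measurable N1 (count_space UNIV)" if "j \<in> J" for j
    unfolding measurable_cong_sets[OF N1 refl] using that J by (intro measurable_component_singleton) auto
  have m2: "(\<lambda>x. x j) \<in> measurable N2 (count_space UNIV)" if "j \<in> J" for j
    unfolding measurable_cong_sets[OF N2 refl] using that J by (intro measurable_component_singleton) auto
  have "measure N1 (space N1 \<inter> {x \<in> space N1. \<forall>j\<in>J. x j \<in> C j})
      = measure N2 (space N2 \<inter> {x \<in> space N2. \<forall>j\<in>J. x j \<in> C j})"
    apply (subst N1.measure_cylinder_eq_sum_atoms[where Y = "\<lambda>j x. x j" and B = C, OF J(1) sets.top m1], assumption)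
    apply (subst N2.measure_cylinder_eq_sum_atoms[where Y = "\<lambda>j x. x j" and B = C, OF J(1) sets.top m2], assumption)
    using eq by (intro sum.cong refl) (simp add: Int_def)
  then show "emeasure N1 (prod_emb I (\<lambda>_. count_space UNIV) F (PiE F A))
      = emeasure N2 (prod_emb I (\<lambda>_. count_space UNIV) F (PiE F A))"
    unfolding emb by (simp add: sp N1.emeasure_eq_measure N2.emeasure_eq_measure)
qed

lemma random_field_measurable:
  assumes "\<And>i. Y i \<in> measurable M (count_space UNIV)"
  shows "(\<lambda>\<omega> i. Y i \<omega>) \<in> measurable M (PiM UNIV (\<lambda>_. count_space UNIV))"
  by (rule measurable_PiM_single') (use assms in auto)

lemma measure_distr_atom:
  fixes Y :: "'i \<Rightarrow> 'a \<Rightarrow> bool"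
  assumes Y: "\<And>i. Y i \<in> measurable M (count_space UNIV)" and "finite J"
  shows "measure (distr M (PiM UNIV (\<lambda>_. count_space UNIV)) (\<lambda>\<omega> i. Y i \<omega>)) {x. \<forall>j\<in>J. x j = \<sigma> j}
    = measure M {\<omega> \<in> space M. \<forall>j\<in>J. Y j \<omega> = \<sigma> j}"
proof -
  have "{x \<in> space (PiM UNIV (\<lambda>_. count_space UNIV)). \<forall>j\<in>J. x j \<in> {\<sigma> j}}
      \<in> sets (PiM UNIV (\<lambda>_. count_space UNIV))"
    using \<open>finite J\<close> by (intro sets_binary_atom measurable_component_singleton) auto
  then have "{x. \<forall>j\<in>J. x j = \<sigma> j} \<in> sets (PiM UNIV (\<lambda>_. count_space UNIV))"
    by (simp add: space_PiM)
  then show ?thesis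
    by (subst measure_distr[OF random_field_measurable[OF Y]]) (auto intro!: arg_cong[where f = "measure M"])
qed

lemma measurable_two_bits:
  fixes Y Z :: "'a \<Rightarrow> bool"
  assumes "Y \<in> measurable M (count_space UNIV)" "Z \<in> measurable M (count_space UNIV)"
  shows "(\<lambda>\<omega>. f (Y \<omega>) (Z \<omega>) :: real) \<in> borel_measurable M"
proof -
  have "(\<lambda>\<omega>. f (Y \<omega>) (Z \<omega>)) = (\<lambda>\<omega>. if Y \<omega> then (if Z \<omega> then f True True else f True False)
      else (if Z \<omega> then f False True else f False False))"
    by auto
  moreover have "Measurable.pred M Y" "Measurable.pred M Z" using assms by auto
  ultimately show ?thesis by simp
qed

section \<open>Algebras generated by binary variables\<close>

lemma space_generated_algebra [simp]: "space (generated_algebra M I Y) = space M"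
  unfolding generated_algebra_def by (rule space_measure_of) auto

lemma sets_generated_algebra:
  "sets (generated_algebra M I Y)
    = sigma_sets (space M) (\<Union>i\<in>I. range (\<lambda>B. Y i -` B \<inter> space M))"
  unfolding generated_algebra_def by (rule sets_measure_of) auto

lemma measurable_generated_algebra:
  "i \<in> I \<Longrightarrow> Y i \<in> measurable (generated_algebra M I Y) (count_space UNIV)"
  by (auto simp: measurable_def sets_generated_algebra)

lemma subalgebra_generated_algebra:
  assumes "\<And>i. i \<in> I \<Longrightarrow> Y i \<in> measurable M (count_space UNIV)"
  shows "subalgebra M (generated_algebra M I Y)"
proof -
  have "(\<Union>i\<in>I. range (\<lambda>B. Y i -` B \<inter> space M)) \<subseteq> sets M"
    using assms by (auto intro: measurable_sets)
  then show ?thesis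
    unfolding subalgebra_def sets_generated_algebra by (auto dest: sets.sigma_sets_subset)
qed

lemma sets_generated_algebra_mono:
  assumes "\<And>i. i \<in> I \<Longrightarrow> \<exists>j\<in>K. Y i = Z j"
  shows "sets (generated_algebra M I Y) \<subseteq> sets (generated_algebra M K Z)"
proof -
  have "Y i -` B \<inter> space M \<in> (\<Union>j\<in>K. range (\<lambda>B. Z j -` B \<inter> space M))" if i: "i \<in> I" for i B
  proof -
    obtain j where "j \<in> K" "Y i = Z j" using assms[OF i] by blast
    then show ?thesis by (intro UN_I[of j]) simp_all
  qed
  then show ?thesis
    unfolding sets_generated_algebra by (intro sigma_sets_mono') blast
qed

text \<open>
  The events of the generated algebra are the preimages of measurable sets of configurations,
  which turns questions about these events into questions about measures on a product space.
\<close>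

lemma generated_algebraE:
  fixes Y :: "'i \<Rightarrow> 'a \<Rightarrow> bool"
  assumes "A \<in> sets (generated_algebra M I Y)"
  obtains S where "S \<in> sets (PiM I (\<lambda>_. count_space UNIV))"
    "A = (\<lambda>\<omega>. \<lambda>i\<in>I. Y i \<omega>) -` S \<inter> space M"
proof -
  let ?P = "PiM I (\<lambda>_. count_space UNIV) :: ('i \<Rightarrow> bool) measure"
  let ?f = "\<lambda>\<omega>. \<lambda>i\<in>I. Y i \<omega>"
  let ?V = "vimage_algebra (space M) ?f ?P"
  have f: "?f \<in> space M \<rightarrow> space ?P" by (auto simp: space_PiM)
  have "Y i -` B \<inter> space M \<in> sets ?V" if "i \<in> I" for i B
  proof -
    have "(\<lambda>x. x i) -` B \<inter> space ?P \<in> sets ?P"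
      using that by (intro measurable_sets[OF measurable_component_singleton]) auto
    then have "?f -` ((\<lambda>x. x i) -` B \<inter> space ?P) \<inter> space M \<in> sets ?V"
      by (rule in_vimage_algebra)
    also have "?f -` ((\<lambda>x. x i) -` B \<inter> space ?P) \<inter> space M = Y i -` B \<inter> space M"
    proof (rule set_eqI)
      fix \<omega>
      have "\<omega> \<in> space M \<Longrightarrow> ?f \<omega> \<in> space ?P" using f by blast
      moreover have "?f \<omega> i = Y i \<omega>" using that by simp
      ultimately show "\<omega> \<in> ?f -` ((\<lambda>x. x i) -` B \<inter> space ?P) \<inter> space M
          \<longleftrightarrow> \<omega> \<in> Y i -` B \<inter> space M"
        by (simp only: vimage_eq Int_iff) blast
    qed
    finally show ?thesis .
  qed
  then have "sigma_sets (space ?V) (\<Union>i\<in>I. range (\<lambda>B. Y i -` B \<inter> space M)) \<subseteq> sets ?V"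
    by (intro sets.sigma_sets_subset) auto
  then have "A \<in> sets ?V"
    using assms by (auto simp: sets_generated_algebra)
  then show thesis
    unfolding sets_vimage_algebra2[OF f] using that by auto
qed

text \<open>
  The form of conditioning used below: to identify \<open>g2\<close> as a conditional version of \<open>g1\<close>, it is
  enough to integrate both over atoms.  The reason is that the images under the field of the
  measures with densities \<open>g1\<close> and \<open>g2\<close> are measures on a space of configurations, hence determined by
  atoms.
\<close>

lemma integral_generated_algebra_eqI:
  fixes Y :: "'i \<Rightarrow> 'a \<Rightarrow> bool"
    and g1 g2 :: "'a \<Rightarrow> real"
  assumes "finite_measure M"
    and Y: "\<And>i. i \<in> I \<Longrightarrow> Y i \<in> measurable M (count_space UNIV)"
    and g1: "integrable M g1" "\<And>\<omega>. 0 \<le> g1 \<omega>" and g2: "integrable M g2" "\<And>\<omega>. 0 \<le> g2 \<omega>"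
    and cofinal: "\<And>F. finite F \<Longrightarrow> F \<subseteq> I \<Longrightarrow> \<exists>J. finite J \<and> F \<subseteq> J \<and> J \<subseteq> I \<and>
      (\<forall>\<sigma>. let A = {\<omega> \<in> space M. \<forall>j\<in>J. Y j \<omega> = \<sigma> j} in
        (\<integral>\<omega>. indicator A \<omega> * g1 \<omega> \<partial>M) = (\<integral>\<omega>. indicator A \<omega> * g2 \<omega> \<partial>M))"
    and A: "A \<in> sets (generated_algebra M I Y)"
  shows "(\<integral>\<omega>. indicator A \<omega> * g1 \<omega> \<partial>M) = (\<integral>\<omega>. indicator A \<omega> * g2 \<omega> \<partial>M)"
proof -
  interpret finite_measure M by fact
  let ?P = "PiM I (\<lambda>_. count_space UNIV) :: ('i \<Rightarrow> bool) measure"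
  let ?f = "\<lambda>\<omega>. \<lambda>i\<in>I. Y i \<omega>"
  \<comment> \<open>The image, on configurations, of the measure with density \<open>g\<close>.\<close>
  define law where "law g = distr (density M (\<lambda>\<omega>. ennreal (g \<omega>))) ?P ?f" for g
  have f [measurable]: "?f \<in> measurable M ?P"
    by (rule measurable_restrict) (use Y in auto)
  have law: "measure (law g) S = (\<integral>\<omega>. indicator (?f -` S \<inter> space M) \<omega> * g \<omega> \<partial>M)"
    if g: "integrable M g" "\<And>\<omega>. 0 \<le> g \<omega>" and S: "S \<in> sets ?P" for g S
  proof -
    have [measurable]: "g \<in> borel_measurable M" using g by auto
    have [measurable]: "?f -` S \<inter> space M \<in> sets M" using S f by (rule measurable_sets[rotated])
    have "measure (law g) S = measure (density M g) (?f -` S \<inter> space M)"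
      unfolding law_def using S by (subst measure_distr) auto
    also have "\<dots> = (\<integral>\<omega>. indicator (?f -` S \<inter> space M) \<omega> \<partial>density M g)"
      by (simp add: Int_def)
    also have "\<dots> = (\<integral>\<omega>. g \<omega> *\<^sub>R indicator (?f -` S \<inter> space M) \<omega> \<partial>M)"
      using g by (intro integral_density) auto
    finally show ?thesis by (simp add: mult.commute)
  qed
  have fin: "finite_measure (law g)" if g: "integrable M g" "\<And>\<omega>. 0 \<le> g \<omega>" for g
  proof -
    have "emeasure (density M g) (space M) < \<infinity>"
      using g by (subst emeasure_density)
        (auto simp: integrable_iff_bounded cong: nn_integral_cong)
    then have "finite_measure (density M g)" by (intro finite_measureI) auto
    then show ?thesis unfolding law_def
      by (rule finite_measure.finite_measure_distr) simp
  qed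
  have "law g1 = law g2"
  proof (rule measure_eqI_binary_atoms[OF _ _ fin[OF g1] fin[OF g2]])
    fix F assume "finite F" "F \<subseteq> I"
    from cofinal[OF this] obtain J where J: "finite J" "F \<subseteq> J" "J \<subseteq> I" and
      eq: "\<And>\<sigma> A. A = {\<omega> \<in> space M. \<forall>j\<in>J. Y j \<omega> = \<sigma> j} \<Longrightarrow>
        (\<integral>\<omega>. indicator A \<omega> * g1 \<omega> \<partial>M) = (\<integral>\<omega>. indicator A \<omega> * g2 \<omega> \<partial>M)"
      unfolding Let_def by auto
    have "{x \<in> space ?P. \<forall>j\<in>J. x j \<in> {\<sigma> j}} \<in> sets ?P" for \<sigma>
      using J by (intro sets_binary_atom measurable_component_singleton) auto
    moreover have "?f -` {x \<in> space ?P. \<forall>j\<in>J. x j = \<sigma> j} \<inter> space M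
        = {\<omega> \<in> space M. \<forall>j\<in>J. Y j \<omega> = \<sigma> j}" for \<sigma>
      using J by (auto simp: space_PiM subset_eq)
    ultimately have "measure (law g1) {x \<in> space ?P. \<forall>j\<in>J. x j = \<sigma> j}
        = measure (law g2) {x \<in> space ?P. \<forall>j\<in>J. x j = \<sigma> j}" for \<sigma>
      using law[OF g1, of "{x \<in> space ?P. \<forall>j\<in>J. x j = \<sigma> j}"]
        law[OF g2, of "{x \<in> space ?P. \<forall>j\<in>J. x j = \<sigma> j}"] eq[OF refl, of \<sigma>] by simp
    then show "\<exists>J. finite J \<and> F \<subseteq> J \<and> J \<subseteq> I \<and>
      (\<forall>\<sigma>. measure (law g1) {x \<in> space (law g1). \<forall>j\<in>J. x j = \<sigma> j}
        = measure (law g2) {x \<in> space (law g2). \<forall>j\<in>J. x j = \<sigma> j})"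
      using J by (intro exI[of _ J]) (simp add: law_def)
  qed (simp_all add: law_def)
  moreover obtain S where "S \<in> sets ?P" "A = ?f -` S \<inter> space M"
    using generated_algebraE[OF A] by blast
  ultimately show ?thesis using law[OF g1, of S] law[OF g2, of S] by simp
qed

section \<open>Products of Bernoulli measures\<close>

lemma sum_pmf_bool: "pmf P True + pmf P False = 1"
  using sum_pmf_eq_1[of UNIV P, OF _ subset_UNIV] by (simp add: UNIV_bool)

lemma measure_PiM_bernoulli_atom:
  assumes "finite J"
  shows "measure (PiM UNIV (\<lambda>i. measure_pmf (bernoulli_pmf (q i)))) {x. \<forall>j\<in>J. x j = \<sigma> j}
    = (\<Prod>j\<in>J. pmf (bernoulli_pmf (q j)) (\<sigma> j))"
proof -
  let ?M = "\<lambda>i. measure_pmf (bernoulli_pmf (q i))"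
  have "{x. \<forall>j\<in>J. x j \<in> C j} = prod_emb UNIV ?M J (PiE J C)" for C
    by (auto simp: prod_emb_def PiE_iff)
  from this[of "\<lambda>j. {\<sigma> j}"]
  have emb: "{x. \<forall>j\<in>J. x j = \<sigma> j} = prod_emb UNIV ?M J (PiE J (\<lambda>j. {\<sigma> j}))"
    by (simp only: singleton_iff)
  have "emeasure (PiM UNIV ?M) {x. \<forall>j\<in>J. x j = \<sigma> j} = (\<Prod>j\<in>J. emeasure (?M j) {\<sigma> j})"
    unfolding emb
    by (rule emeasure_PiM_emb) (use assms measure_pmf.prob_space_axioms in auto)
  also have "\<dots> = ennreal (\<Prod>j\<in>J. pmf (bernoulli_pmf (q j)) (\<sigma> j))"
    by (simp add: emeasure_pmf_single prod_ennreal)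
  finally show ?thesis
    by (simp add: measure_def prod_nonneg)
qed

lemma sets_PiM_bernoulli:
  "sets (PiM I (\<lambda>i. measure_pmf (bernoulli_pmf (q i)))) = sets (PiM I (\<lambda>_. count_space UNIV))"
  by (rule sets_PiM_cong) simp_all

lemma space_PiM_bernoulli [simp]:
  "space (PiM UNIV (\<lambda>i. measure_pmf (bernoulli_pmf (q i)))) = UNIV"
  by (simp add: space_PiM)

lemma prob_space_PiM_bernoulli:
  "prob_space (PiM UNIV (\<lambda>i. measure_pmf (bernoulli_pmf (q i))))"
  by (rule prob_space_PiM) (rule measure_pmf.prob_space_axioms)

lemma (in prob_space) bernoulli_field_iid:
  assumes Y: "\<And>i. Y i \<in> measurable M (count_space UNIV)"
    and law: "distr M (PiM UNIV (\<lambda>_. count_space UNIV)) (\<lambda>\<omega> i. Y i \<omega>) = bernoulli_field p"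
  shows "indep_vars (\<lambda>_. count_space UNIV) Y UNIV"
    and "distr M (count_space UNIV) (Y i) = measure_pmf (bernoulli_pmf p)"
proof -
  show marginal: "distr M (count_space UNIV) (Y i) = measure_pmf (bernoulli_pmf p)" for i
  proof -
    have "distr M (count_space UNIV) (Y i)
        = distr (distr M (PiM UNIV (\<lambda>_. count_space UNIV)) (\<lambda>\<omega> i. Y i \<omega>)) (count_space UNIV) (\<lambda>x. x i)"
      by (subst distr_distr[OF measurable_component_singleton random_field_measurable[OF Y]])
        (simp_all add: comp_def)
    also have "\<dots> = distr (bernoulli_field p) (measure_pmf (bernoulli_pmf p)) (\<lambda>x. x i)"
      unfolding law by (rule distr_cong) simp_all
    also have "\<dots> = measure_pmf (bernoulli_pmf p)"
      unfolding bernoulli_field_def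
      by (rule distr_PiM_component) (simp_all add: measure_pmf.prob_space_axioms)
    finally show ?thesis .
  qed
  show "indep_vars (\<lambda>_. count_space UNIV) Y UNIV"
    by (subst indep_vars_iff_distr_eq_PiM') (use Y law in \<open>simp_all add: marginal bernoulli_field_def restrict_UNIV\<close>)
qed

section \<open>Weights of configurations on triangles\<close>

text \<open>
  The site \<open>(n, k)\<close> is seen here as a child: its parents are \<open>(n - 1, k)\<close> and \<open>(n - 1, k + 1)\<close>.
\<close>

definition update_prob :: "(bool \<Rightarrow> bool \<Rightarrow> real) \<Rightarrow> (int \<times> int \<Rightarrow> bool) \<Rightarrow> int \<times> int \<Rightarrow> real"
  where "update_prob \<theta> \<sigma> = (\<lambda>(n, k). pmf (bernoulli_pmf (\<theta> (\<sigma> (n - 1, k)) (\<sigma> (n - 1, k + 1)))) (\<sigma> (n, k)))"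

text \<open>
  The probability of the configuration \<open>\<sigma>\<close> when the sites of \<open>B\<close> are independent Bernoulli
  variables and the sites of \<open>U\<close> are then updated from their parents.
\<close>

definition region_weight ::
    "(bool \<Rightarrow> bool \<Rightarrow> real) \<Rightarrow> real \<Rightarrow> (int \<times> int) set \<Rightarrow> (int \<times> int) set \<Rightarrow> (int \<times> int \<Rightarrow> bool) \<Rightarrow> real"
  where "region_weight \<theta> p B U \<sigma>
    = (\<Prod>s\<in>B. pmf (bernoulli_pmf p) (\<sigma> s)) * (\<Prod>s\<in>U. update_prob \<theta> \<sigma> s)"

definition agreement :: "'a measure \<Rightarrow> (int \<Rightarrow> int \<Rightarrow> 'a \<Rightarrow> bool) \<Rightarrow> (int \<times> int) set \<Rightarrow> (int \<times> int \<Rightarrow> bool) \<Rightarrow> 'a set"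
  where "agreement M X R \<sigma> = {\<omega> \<in> space M. \<forall>s\<in>R. X (fst s) (snd s) \<omega> = \<sigma> s}"

definition region_law ::
    "(bool \<Rightarrow> bool \<Rightarrow> real) \<Rightarrow> real \<Rightarrow> 'a measure \<Rightarrow> (int \<Rightarrow> int \<Rightarrow> 'a \<Rightarrow> bool) \<Rightarrow> (int \<times> int) set \<Rightarrow> (int \<times> int) set \<Rightarrow> bool"
  where "region_law \<theta> p M X B U \<longleftrightarrow>
    (\<forall>\<sigma>. measure M (agreement M X (B \<union> U) \<sigma>) = region_weight \<theta> p B U \<sigma>)"

definition triangle_base :: "int \<Rightarrow> int \<Rightarrow> int \<Rightarrow> (int \<times> int) set"
  where "triangle_base a b c = {a} \<times> {b..c - a}"

definition triangle_upper :: "int \<Rightarrow> int \<Rightarrow> int \<Rightarrow> (int \<times> int) set"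
  where "triangle_upper a b c = {(n, k). a < n \<and> b \<le> k \<and> n + k \<le> c}"

text \<open>
  Triangles are the regions on which this law survives the rotation: a triangle has three sides, and
  turning it by \<open>2\<pi>/3\<close> only exchanges the side that serves as base.
\<close>

definition triangle_law ::
    "(bool \<Rightarrow> bool \<Rightarrow> real) \<Rightarrow> real \<Rightarrow> 'a measure \<Rightarrow> (int \<Rightarrow> int \<Rightarrow> 'a \<Rightarrow> bool) \<Rightarrow> bool"
  where "triangle_law \<theta> p M X \<longleftrightarrow>
    (\<forall>a b c. region_law \<theta> p M X (triangle_base a b c) (triangle_upper a b c))"

lemma finite_triangle_base [simp]: "finite (triangle_base a b c)"
  by (simp add: triangle_base_def)

lemma finite_triangle_upper [simp]: "finite (triangle_upper a b c)"
  by (rule finite_subset[of _ "{a..c - b} \<times> {b..c - a}"]) (auto simp: triangle_upper_def)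

lemma triangle_base_Un_upper:
  "triangle_base a b c \<union> triangle_upper a b c = {(n, k). a \<le> n \<and> b \<le> k \<and> n + k \<le> c}"
  by (auto simp: triangle_base_def triangle_upper_def)

text \<open>
  The bound \<open>a \<le> h\<close> makes the triangle reach down to row \<open>h\<close> even if \<open>F\<close> lies above it.
\<close>

lemma finite_sites_in_triangle:
  assumes "finite F"
  obtains a b c :: int where "F \<subseteq> {(n, k). a \<le> n \<and> b \<le> k \<and> n + k \<le> c}" "a \<le> h"
proof
  \<comment> \<open>The inserted elements make the extrema defined when \<open>F\<close> is empty.\<close>
  let ?F1 = "insert h (fst ` F)" and ?F2 = "insert 0 (snd ` F)" and ?F3 = "insert 0 ((\<lambda>s. fst s + snd s) ` F)"
  show "F \<subseteq> {(n, k). Min ?F1 \<le> n \<and> Min ?F2 \<le> k \<and> n + k \<le> Max ?F3}"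
    using assms by (force intro!: Min_le Max_ge)
  show "Min ?F1 \<le> h" using assms by simp
qed

lemma agreement_sets:
  assumes "finite R" "\<And>n k. X n k \<in> measurable M (count_space UNIV)"
  shows "agreement M X R \<sigma> \<in> sets M"
  using sets_binary_atom[of R "\<lambda>s. X (fst s) (snd s)" M "\<lambda>s. {\<sigma> s}"] assms
  by (simp add: agreement_def)

lemma agreement_Un: "agreement M X (R \<union> S) \<sigma> = agreement M X R \<sigma> \<inter> agreement M X S \<sigma>"
  unfolding agreement_def by blast

lemma agreement_row:
  "agreement M X ({n} \<times> J) \<sigma> = {\<omega> \<in> space M. \<forall>k\<in>J. X n k \<omega> = \<sigma> (n, k)}"
proof -
  have "(\<forall>s\<in>{n} \<times> J. P s) \<longleftrightarrow> (\<forall>k\<in>J. P (n, k))" for P by auto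
  then show ?thesis by (simp only: agreement_def fst_conv snd_conv)
qed

lemma agreement_cong:
  assumes "\<And>s. s \<in> R \<Longrightarrow> \<sigma> s = \<tau> s"
  shows "agreement M X R \<sigma> = agreement M X R \<tau>"
proof -
  have "(\<forall>s\<in>R. X (fst s) (snd s) \<omega> = \<sigma> s) \<longleftrightarrow> (\<forall>s\<in>R. X (fst s) (snd s) \<omega> = \<tau> s)" for \<omega>
    using assms by (intro ball_cong) simp_all
  then show ?thesis by (simp only: agreement_def)
qed

lemma agreementD:
  assumes "\<omega> \<in> agreement M X R \<sigma>" "(n, k) \<in> R"
  shows "X n k \<omega> = \<sigma> (n, k)"
proof -
  have "\<forall>s\<in>R. X (fst s) (snd s) \<omega> = \<sigma> s"
    using assms(1) unfolding agreement_def by blast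
  from bspec[OF this assms(2)] show ?thesis by (simp only: fst_conv snd_conv)
qed

text \<open>
  If \<open>s\<close> has no child in the region, its value occurs in only one factor of the weight, and the two
  values of this factor have sum one.
\<close>

lemma region_law_remove_top:
  assumes "finite_measure M" and X: "\<And>n k. X n k \<in> measurable M (count_space UNIV)"
    and law: "region_law \<theta> p M X B U" and fin: "finite B" "finite U"
    and s: "s \<in> U" "s \<notin> B"
    and childless: "\<And>n k. (n, k) \<in> U \<Longrightarrow> (n - 1, k) \<noteq> s \<and> (n - 1, k + 1) \<noteq> s"
  shows "region_law \<theta> p M X B (U - {s})"
  unfolding region_law_def
proof
  fix \<sigma> :: "int \<times> int \<Rightarrow> bool"
  interpret finite_measure M by fact
  \<comment> \<open>The parents of \<open>s\<close> differ from \<open>s\<close>, so the parameter of its update does not depend on \<open>\<sigma> s\<close>.\<close>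
  define q where "q = \<theta> (\<sigma> (fst s - 1, snd s)) (\<sigma> (fst s - 1, snd s + 1))"
  have split: "agreement M X (B \<union> (U - {s})) \<sigma>
      = agreement M X (B \<union> U) (\<sigma>(s := True)) \<union> agreement M X (B \<union> U) (\<sigma>(s := False))"
    using s by (auto simp: agreement_def)
  have weight: "region_weight \<theta> p B U (\<sigma>(s := v))
      = region_weight \<theta> p B (U - {s}) \<sigma> * pmf (bernoulli_pmf q) v" for v
  proof -
    have "(\<Prod>t\<in>B. pmf (bernoulli_pmf p) ((\<sigma>(s := v)) t)) = (\<Prod>t\<in>B. pmf (bernoulli_pmf p) (\<sigma> t))"
      using s by (intro prod.cong refl) auto
    moreover have "(\<Prod>t\<in>U. update_prob \<theta> (\<sigma>(s := v)) t)
        = update_prob \<theta> (\<sigma>(s := v)) s * (\<Prod>t\<in>U - {s}. update_prob \<theta> (\<sigma>(s := v)) t)"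
      using fin s by (intro prod.remove) auto
    moreover have "update_prob \<theta> (\<sigma>(s := v)) s = pmf (bernoulli_pmf q) v"
      by (cases s) (simp add: update_prob_def q_def)
    moreover have "(\<Prod>t\<in>U - {s}. update_prob \<theta> (\<sigma>(s := v)) t) = (\<Prod>t\<in>U - {s}. update_prob \<theta> \<sigma> t)"
      using childless by (intro prod.cong refl) (auto simp: update_prob_def)
    ultimately show ?thesis by (simp add: region_weight_def mult_ac)
  qed
  have "measure M (agreement M X (B \<union> (U - {s})) \<sigma>)
      = measure M (agreement M X (B \<union> U) (\<sigma>(s := True)))
        + measure M (agreement M X (B \<union> U) (\<sigma>(s := False)))"
    unfolding split
  proof (rule finite_measure_Union)
    show "agreement M X (B \<union> U) (\<sigma>(s := True)) \<inter> agreement M X (B \<union> U) (\<sigma>(s := False)) = {}"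
      using s by (auto simp: agreement_def)
  qed (use fin X in \<open>auto intro!: agreement_sets\<close>)
  also have "\<dots> = region_weight \<theta> p B (U - {s}) \<sigma> * (pmf (bernoulli_pmf q) True + pmf (bernoulli_pmf q) False)"
    using law by (simp add: region_law_def weight distrib_left)
  finally show "measure M (agreement M X (B \<union> (U - {s})) \<sigma>) = region_weight \<theta> p B (U - {s}) \<sigma>"
    by (simp only: sum_pmf_bool mult_1_right)
qed

text \<open>
  The sites of \<open>U - V\<close> are summed out in order of decreasing height, so that the site to be
  removed never has a child left.  This is why \<open>V\<close> has to contain, up to the base, the parents of
  its sites.
\<close>

lemma region_law_marginal:
  assumes M: "finite_measure M" and X: "\<And>n k. X n k \<in> measurable M (count_space UNIV)"
    and law: "region_law \<theta> p M X B U" and fin: "finite B" "finite U"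
    and disj: "B \<inter> U = {}" and sub: "V \<subseteq> U"
    and closed: "\<And>n k. (n, k) \<in> V \<Longrightarrow> (n - 1, k) \<in> B \<union> V \<and> (n - 1, k + 1) \<in> B \<union> V"
  shows "region_law \<theta> p M X B V"
  using law fin disj sub
proof (induction "card (U - V)" arbitrary: U)
  case 0
  then have "U = V" by auto
  then show ?case using 0 by simp
next
  case (Suc m)
  then have ne: "fst ` (U - V) \<noteq> {}" "finite (fst ` (U - V))" by fastforce+
  then have "Max (fst ` (U - V)) \<in> fst ` (U - V)" by (intro Max_in)
  then obtain s where s: "s \<in> U - V" and "fst s = Max (fst ` (U - V))"
    by (metis imageE)
  then have top: "fst t \<le> fst s" if "t \<in> U - V" for t
    unfolding \<open>fst s = Max (fst ` (U - V))\<close> using ne that by (intro Max_ge) auto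
  have "region_law \<theta> p M X B (U - {s})"
  proof (rule region_law_remove_top[OF M X])
    fix n k assume nk: "(n, k) \<in> U"
    show "(n - 1, k) \<noteq> s \<and> (n - 1, k + 1) \<noteq> s"
    \<comment> \<open>A child of \<open>s\<close> in \<open>V\<close> would force \<open>s\<close> into the base or \<open>V\<close>; outside \<open>V\<close> it would be higher than \<open>s\<close>.\<close>
    proof (cases "(n, k) \<in> V")
      case True
      then show ?thesis using closed[OF True] s Suc.prems by auto
    next
      case False
      then show ?thesis using top[of "(n, k)"] nk by auto
    qed
  qed (use Suc.prems s in auto)
  moreover have "card (U - {s} - V) = m"
  proof -
    have "U - {s} - V = U - V - {s}" by auto
    then show ?thesis using Suc.hyps(2) s Suc.prems by (simp add: card_Diff_singleton)
  qed
  ultimately show ?case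
    using Suc.prems s by (intro Suc.hyps(1)[of "U - {s}"]) auto
qed

section \<open>Turning a triangle\<close>

text \<open>
  For \<open>u = y\<close> the factors \<open>\<mu>\<close> agree and the equation reduces to \<open>\<phi> x y = \<theta> y x\<close>.  For \<open>u \<noteq> y\<close> it is
  the stationarity hypothesis, written as \<open>p * (1 - \<theta> True x) = (1 - p) * \<theta> False x\<close>.
\<close>

lemma bernoulli_rule_balance:
  assumes range: "\<And>x y. 0 \<le> \<theta> x y \<and> \<theta> x y \<le> 1" and p: "0 \<le> p" "p \<le> 1"
    and inv: "\<And>x. (1 - p) * \<theta> False x + p * \<theta> True x = p"
    and \<phi>: "\<And>x y. \<phi> x y = \<theta> y x"
  shows "pmf (bernoulli_pmf p) u * pmf (bernoulli_pmf (\<theta> u x)) y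
    = pmf (bernoulli_pmf p) y * pmf (bernoulli_pmf (\<phi> x y)) u"
  using inv[of x] p range
  by (cases u; cases y) (auto simp: \<phi> algebra_simps)

text \<open>
  The sites \<open>(n, k)\<close> of one column form a chain of left parents.  Each use of the balance equation
  lifts the factor \<open>\<mu>\<close> by one site and replaces the factor of the new cell by the
  reversed factor of its left parent.
\<close>

lemma column_reversal:
  assumes balance: "\<And>u x y. pmf (bernoulli_pmf p) u * pmf (bernoulli_pmf (\<theta> u x)) y
      = pmf (bernoulli_pmf p) y * pmf (bernoulli_pmf (\<phi> x y)) u"
    and "a \<le> t"
  shows "pmf (bernoulli_pmf p) (\<sigma> (a, k)) * (\<Prod>n\<in>{a<..t}. update_prob \<theta> \<sigma> (n, k))
    = pmf (bernoulli_pmf p) (\<sigma> (t, k))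
      * (\<Prod>n\<in>{a..<t}. pmf (bernoulli_pmf (\<phi> (\<sigma> (n, k + 1)) (\<sigma> (n + 1, k)))) (\<sigma> (n, k)))"
  using \<open>a \<le> t\<close>
proof (induction t rule: int_ge_induct)
  case base
  then show ?case by simp
next
  case (step t)
  let ?\<mu> = "\<lambda>n. pmf (bernoulli_pmf p) (\<sigma> (n, k))"
  let ?r = "\<lambda>n. pmf (bernoulli_pmf (\<phi> (\<sigma> (n, k + 1)) (\<sigma> (n + 1, k)))) (\<sigma> (n, k))"
  have split: "{a<..t + 1} = insert (t + 1) {a<..t}" "{a..<t + 1} = insert t {a..<t}"
    using step.hyps by auto
  have "?\<mu> a * (\<Prod>n\<in>{a<..t + 1}. update_prob \<theta> \<sigma> (n, k))
      = update_prob \<theta> \<sigma> (t + 1, k) * (?\<mu> a * (\<Prod>n\<in>{a<..t}. update_prob \<theta> \<sigma> (n, k)))"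
    unfolding split by simp
  also have "\<dots> = (?\<mu> t * update_prob \<theta> \<sigma> (t + 1, k)) * (\<Prod>n\<in>{a..<t}. ?r n)"
    unfolding step.IH by simp
  also have "?\<mu> t * update_prob \<theta> \<sigma> (t + 1, k) = ?\<mu> (t + 1) * ?r t"
    using balance by (simp add: update_prob_def)
  also have "?\<mu> (t + 1) * ?r t * (\<Prod>n\<in>{a..<t}. ?r n) = ?\<mu> (t + 1) * (\<Prod>n\<in>{a..<t + 1}. ?r n)"
    unfolding split by simp
  finally show ?case .
qed

text \<open>
  Product of the column reversals over all columns.  The tops \<open>(c - k, k)\<close> of the columns are the
  base of the turned triangle, and its other sites are the lower sites of the columns.
\<close>

lemma region_weight_rotate:
  assumes balance: "\<And>u x y. pmf (bernoulli_pmf p) u * pmf (bernoulli_pmf (\<theta> u x)) y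
      = pmf (bernoulli_pmf p) y * pmf (bernoulli_pmf (\<phi> x y)) u"
  shows "region_weight \<theta> p (triangle_base a b c) (triangle_upper a b c) \<sigma>
    = region_weight \<phi> p (triangle_base (- c) a (- b)) (triangle_upper (- c) a (- b))
        (\<lambda>(m, j). \<sigma> (j, - m - j))"
proof -
  let ?\<mu> = "\<lambda>s. pmf (bernoulli_pmf p) (\<sigma> s)"
  let ?r = "\<lambda>n k. pmf (bernoulli_pmf (\<phi> (\<sigma> (n, k + 1)) (\<sigma> (n + 1, k)))) (\<sigma> (n, k))"
  have "region_weight \<theta> p (triangle_base a b c) (triangle_upper a b c) \<sigma>
      = (\<Prod>k\<in>{b..c - a}. ?\<mu> (a, k)) * (\<Prod>k\<in>{b..c - a}. \<Prod>n\<in>{a<..c - k}. update_prob \<theta> \<sigma> (n, k))"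
    unfolding region_weight_def
  proof (intro arg_cong2[where f = "(*)"])
    show "(\<Prod>s\<in>triangle_base a b c. ?\<mu> s) = (\<Prod>k\<in>{b..c - a}. ?\<mu> (a, k))"
      by (rule prod.reindex_bij_witness[of _ "\<lambda>k. (a, k)" snd]) (auto simp: triangle_base_def)
    show "(\<Prod>s\<in>triangle_upper a b c. update_prob \<theta> \<sigma> s)
        = (\<Prod>k\<in>{b..c - a}. \<Prod>n\<in>{a<..c - k}. update_prob \<theta> \<sigma> (n, k))"
      by (subst prod.Sigma, simp, simp,
          rule prod.reindex_bij_witness[of _ prod.swap prod.swap])
        (auto simp: triangle_upper_def)
  qed
  also have "\<dots> = (\<Prod>k\<in>{b..c - a}. ?\<mu> (c - k, k) * (\<Prod>n\<in>{a..<c - k}. ?r n k))"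
    unfolding prod.distrib[symmetric]
    by (intro prod.cong refl column_reversal balance) auto
  also have "\<dots> = (\<Prod>k\<in>{b..c - a}. ?\<mu> (c - k, k)) * (\<Prod>k\<in>{b..c - a}. \<Prod>n\<in>{a..<c - k}. ?r n k)"
    by (rule prod.distrib)
  also have "\<dots> = region_weight \<phi> p (triangle_base (- c) a (- b)) (triangle_upper (- c) a (- b))
        (\<lambda>(m, j). \<sigma> (j, - m - j))"
    unfolding region_weight_def
  proof (intro arg_cong2[where f = "(*)"])
    show "(\<Prod>k\<in>{b..c - a}. ?\<mu> (c - k, k))
        = (\<Prod>s\<in>triangle_base (- c) a (- b). pmf (bernoulli_pmf p) ((\<lambda>(m, j). \<sigma> (j, - m - j)) s))"
      by (rule prod.reindex_bij_witness[of _ "\<lambda>s. c - snd s" "\<lambda>k. (- c, c - k)"])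
        (auto simp: triangle_base_def)
    show "(\<Prod>k\<in>{b..c - a}. \<Prod>n\<in>{a..<c - k}. ?r n k)
        = (\<Prod>s\<in>triangle_upper (- c) a (- b). update_prob \<phi> (\<lambda>(m, j). \<sigma> (j, - m - j)) s)"
      by (subst prod.Sigma, simp, simp,
          rule prod.reindex_bij_witness[of _ "\<lambda>(m, j). (- m - j, j)" "\<lambda>(k, n). (- n - k, n)"])
        (auto simp: triangle_upper_def update_prob_def algebra_simps)
  qed
  finally show ?thesis .
qed

lemma triangle_law_rotate:
  assumes balance: "\<And>u x y. pmf (bernoulli_pmf p) u * pmf (bernoulli_pmf (\<theta> u x)) y
      = pmf (bernoulli_pmf p) y * pmf (bernoulli_pmf (\<phi> x y)) u"
    and law: "triangle_law \<theta> p M X"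
  shows "triangle_law \<phi> p M (\<lambda>m j. X j (- m - j))"
  unfolding triangle_law_def region_law_def
proof (intro allI)
  fix a b c :: int and \<tau> :: "int \<times> int \<Rightarrow> bool"
  \<comment> \<open>The configuration \<open>\<tau>\<close> of the turned field, read at the original sites.\<close>
  define \<sigma> where "\<sigma> = (\<lambda>(n, k). \<tau> (- n - k, n))"
  have \<tau>: "\<tau> = (\<lambda>(m, j). \<sigma> (j, - m - j))"
    by (auto simp: \<sigma>_def)
  have "agreement M (\<lambda>m j. X j (- m - j)) (triangle_base a b c \<union> triangle_upper a b c) \<tau>
      = agreement M X (triangle_base b (- c) (- a) \<union> triangle_upper b (- c) (- a)) \<sigma>"
    unfolding agreement_def triangle_base_Un_upper fst_conv
  proof (rule Collect_cong, rule conj_cong[OF refl], rule iffI; rule ballI)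
    fix \<omega> s
    assume *: "\<forall>s\<in>{(n, k). a \<le> n \<and> b \<le> k \<and> n + k \<le> c}. X (snd s) (- fst s - snd s) \<omega> = \<tau> s"
      and s: "s \<in> {(n, k). b \<le> n \<and> - c \<le> k \<and> n + k \<le> - a}"
    from s have "(- fst s - snd s, fst s) \<in> {(n, k). a \<le> n \<and> b \<le> k \<and> n + k \<le> c}" by auto
    from *[rule_format, OF this] show "X (fst s) (snd s) \<omega> = \<sigma> s"
      by (cases s) (simp add: \<sigma>_def)
  next
    fix \<omega> s
    assume *: "\<forall>s\<in>{(n, k). b \<le> n \<and> - c \<le> k \<and> n + k \<le> - a}. X (fst s) (snd s) \<omega> = \<sigma> s"
      and s: "s \<in> {(n, k). a \<le> n \<and> b \<le> k \<and> n + k \<le> c}"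
    from s have "(snd s, - fst s - snd s) \<in> {(n, k). b \<le> n \<and> - c \<le> k \<and> n + k \<le> - a}" by auto
    from *[rule_format, OF this] show "X (snd s) (- fst s - snd s) \<omega> = \<tau> s"
      by (cases s) (simp add: \<sigma>_def)
  qed
  then show "measure M (agreement M (\<lambda>m j. X j (- m - j)) (triangle_base a b c \<union> triangle_upper a b c) \<tau>)
      = region_weight \<phi> p (triangle_base a b c) (triangle_upper a b c) \<tau>"
    using law region_weight_rotate[where a = b and b = "- c" and c = "- a" and \<sigma> = \<sigma>, OF balance]
    by (simp add: triangle_law_def region_law_def \<tau>)
qed

section \<open>A stationary diagram obeys the triangle law\<close>

abbreviation past :: "'a measure \<Rightarrow> (int \<Rightarrow> int \<Rightarrow> 'a \<Rightarrow> bool) \<Rightarrow> int \<Rightarrow> 'a measure"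
  where "past M X n \<equiv> generated_algebra M ({..n} \<times> UNIV) (\<lambda>(m, k). X m k)"

lemma past_sets:
  assumes "finite R" "R \<subseteq> {..n} \<times> UNIV"
  shows "agreement M X R \<sigma> \<in> sets (past M X n)"
proof -
  have "{\<omega> \<in> space (past M X n). \<forall>s\<in>R. (\<lambda>(m, k). X m k) s \<omega> \<in> {\<sigma> s}} \<in> sets (past M X n)"
  proof (rule sets_binary_atom[OF assms(1)])
    show "(\<lambda>(m, k). X m k) s \<in> measurable (past M X n) (count_space UNIV)" if "s \<in> R" for s
      using that assms(2) by (intro measurable_generated_algebra) auto
  qed
  then show ?thesis by (simp add: agreement_def case_prod_unfold)
qed

lemma past_row_measurable:
  "X n k \<in> measurable (past M X n) (count_space UNIV)"
  using measurable_generated_algebra[of "(n, k)" "{..n} \<times> UNIV" "\<lambda>(m, k). X m k" M] by simp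

lemma past_subalgebra:
  assumes "\<And>n k. X n k \<in> measurable M (count_space UNIV)"
  shows "subalgebra M (past M X n)"
  by (rule subalgebra_generated_algebra) (use assms in auto)

text \<open>
  The conditional statements that define a diagram hold almost everywhere.  Integrated over an
  event of the past, they become an equation between probabilities, which can be iterated.
\<close>

lemma stationary_diagram_one_step:
  assumes range: "\<And>x y. 0 \<le> \<theta> x y \<and> \<theta> x y \<le> 1"
    and diagram: "stationary_diagram \<theta> p M X"
    and J: "finite J" and A: "A \<in> sets (past M X n)"
  shows "measure M (A \<inter> {\<omega> \<in> space M. \<forall>j\<in>J. X (n + 1) j \<omega> = \<tau> j})
    = (\<integral>\<omega>. indicator A \<omega> * (\<Prod>j\<in>J. pmf (bernoulli_pmf (\<theta> (X n j \<omega>) (X n (j + 1) \<omega>))) (\<tau> j)) \<partial>M)"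
proof -
  have X [measurable]: "X n k \<in> measurable M (count_space UNIV)" for n k
    using diagram by (auto simp: stationary_diagram_def)
  interpret prob_space M using diagram by (auto simp: stationary_diagram_def)
  interpret F: finite_measure_subalgebra M "past M X n"
    by unfold_locales (rule past_subalgebra[OF X])
  let ?\<kappa> = "\<lambda>j v \<omega>. pmf (bernoulli_pmf (\<theta> (X n j \<omega>) (X n (j + 1) \<omega>))) v"
  let ?E = "{\<omega> \<in> space M. \<forall>j\<in>J. X (n + 1) j \<omega> \<in> {\<tau> j}}"
  have E [measurable]: "?E \<in> sets M" using J X by (intro sets_binary_atom) auto
  have AM [measurable]: "A \<in> sets M" using A F.subalg by (auto simp: subalgebra_def)
  have one: "AE \<omega> in M. cprob M (past M X n) (\<lambda>\<omega>. X (n + 1) k \<omega>) \<omega> = \<theta> (X n k \<omega>) (X n (k + 1) \<omega>)" for k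
    using diagram by (auto simp: stationary_diagram_def Let_def)
  have single: "AE \<omega> in M. cprob M (past M X n) (\<lambda>\<omega>. X (n + 1) j \<omega> \<in> {v}) \<omega> = ?\<kappa> j v \<omega>" for j v
  proof (cases v)
    case True
    then show ?thesis using one[of j] range by simp
  next
    case False
    \<comment> \<open>A diagram only prescribes the conditional probability of the value \<open>True\<close>; that of \<open>False\<close> is the complement.\<close>
    let ?f = "indicator {\<omega> \<in> space M. X (n + 1) j \<omega>} :: 'a \<Rightarrow> real"
    have f: "integrable M ?f" by (simp add: integrable_indicator_iff emeasure_eq_measure)
    have "AE \<omega> in M. real_cond_exp M (past M X n) (\<lambda>\<omega>. 1 - ?f \<omega>) \<omega>
        = real_cond_exp M (past M X n) (\<lambda>_. 1) \<omega> - real_cond_exp M (past M X n) ?f \<omega>"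
      by (rule F.real_cond_exp_diff) (use f in auto)
    moreover have "AE \<omega> in M. real_cond_exp M (past M X n) (\<lambda>_. 1) \<omega> = 1"
      by (rule F.real_cond_exp_F_meas) auto
    moreover have "AE \<omega> in M. real_cond_exp M (past M X n) (\<lambda>\<omega>. 1 - ?f \<omega>) \<omega>
        = cprob M (past M X n) (\<lambda>\<omega>. X (n + 1) j \<omega> \<in> {v}) \<omega>"
      unfolding cprob_def
      by (rule F.real_cond_exp_cong) (auto simp: indicator_def False)
    ultimately show ?thesis
      using one[of j] by eventually_elim (use range False in \<open>simp add: cprob_def\<close>)
  qed
  have prod: "AE \<omega> in M. cprob M (past M X n) (\<lambda>\<omega>. \<forall>j\<in>J. X (n + 1) j \<omega> \<in> {\<tau> j}) \<omega>
      = (\<Prod>j\<in>J. cprob M (past M X n) (\<lambda>\<omega>. X (n + 1) j \<omega> \<in> {\<tau> j}) \<omega>)"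
  proof -
    have "cond_indep_vars M (past M X n) (X (n + 1)) UNIV"
      using diagram by (auto simp: stationary_diagram_def Let_def)
    then show ?thesis
      unfolding cond_indep_vars_def using J by (elim allE[of _ J] allE[of _ "\<lambda>j. {\<tau> j}"]) simp
  qed
  have "AE \<omega> in M. \<forall>j\<in>J. cprob M (past M X n) (\<lambda>\<omega>. X (n + 1) j \<omega> \<in> {\<tau> j}) \<omega> = ?\<kappa> j (\<tau> j) \<omega>"
    using J by (rule AE_finite_allI) (rule single)
  with prod have cond: "AE \<omega> in M. real_cond_exp M (past M X n) (indicator ?E) \<omega> = (\<Prod>j\<in>J. ?\<kappa> j (\<tau> j) \<omega>)"
    by eventually_elim (simp add: cprob_def)
  have [measurable]: "(\<lambda>\<omega>. ?\<kappa> j v \<omega>) \<in> borel_measurable M" for j v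
    by (rule measurable_two_bits[OF X X])
  have "measure M (A \<inter> ?E) = (\<integral>\<omega>. indicator (A \<inter> ?E) \<omega> \<partial>M)"
    using sets.sets_into_space[OF AM] by (simp add: Int_absorb2 le_infI1)
  also have "\<dots> = (\<integral>\<omega>\<in>A. indicator ?E \<omega> \<partial>M)"
    by (simp add: set_lebesgue_integral_def indicator_inter_arith)
  also have "\<dots> = (\<integral>\<omega>\<in>A. real_cond_exp M (past M X n) (indicator ?E) \<omega> \<partial>M)"
    by (rule F.real_cond_exp_intA) (simp_all add: A integrable_indicator_iff emeasure_eq_measure)
  also have "\<dots> = (\<integral>\<omega>. indicator A \<omega> * (\<Prod>j\<in>J. ?\<kappa> j (\<tau> j) \<omega>) \<partial>M)"
    unfolding set_lebesgue_integral_def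
  proof (rule integral_cong_AE)
    show "AE \<omega> in M. indicator A \<omega> *\<^sub>R real_cond_exp M (past M X n) (indicator ?E) \<omega>
        = indicator A \<omega> * (\<Prod>j\<in>J. ?\<kappa> j (\<tau> j) \<omega>)"
      using cond by eventually_elim simp
  qed auto
  finally show ?thesis by simp
qed

text \<open>
  The triangle is built row by row: the configuration on the lower rows is an event of the past,
  on which the parents of the next row are fixed, so that the integral of the one-step
  probabilities is a product.
\<close>

lemma stationary_diagram_triangle_law:
  assumes range: "\<And>x y. 0 \<le> \<theta> x y \<and> \<theta> x y \<le> 1"
    and diagram: "stationary_diagram \<theta> p M X"
  shows "triangle_law \<theta> p M X"
  unfolding triangle_law_def
proof (intro allI)
  fix a b c :: int
  have X: "X n k \<in> measurable M (count_space UNIV)" for n k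
    using diagram by (auto simp: stationary_diagram_def)
  interpret prob_space M using diagram by (auto simp: stationary_diagram_def)
  let ?B = "triangle_base a b c"
  \<comment> \<open>The sites of the triangle strictly above the base, up to row \<open>m\<close>.\<close>
  define V where "V m = {(n, k). a < n \<and> n \<le> m \<and> b \<le> k \<and> n + k \<le> c}" for m
  have V_fin: "finite (V m)" for m
    by (rule finite_subset[OF _ finite_triangle_upper[of a b c]]) (auto simp: V_def triangle_upper_def)
  have rows: "region_law \<theta> p M X ?B (V m)" if "a \<le> m" for m
    using that
  proof (induction m rule: int_ge_induct)
    case base
    have "measure M (agreement M X ?B \<sigma>) = (\<Prod>s\<in>?B. pmf (bernoulli_pmf p) (\<sigma> s))" for \<sigma>
    proof -
      have "distr M (PiM UNIV (\<lambda>_. count_space UNIV)) (\<lambda>\<omega> k. X a k \<omega>) = bernoulli_field p"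
        using diagram by (auto simp: stationary_diagram_def)
      then have "measure M {\<omega> \<in> space M. \<forall>k\<in>{b..c - a}. X a k \<omega> = \<sigma> (a, k)}
          = (\<Prod>k\<in>{b..c - a}. pmf (bernoulli_pmf p) (\<sigma> (a, k)))"
        using measure_distr_atom[of "X a" M "{b..c - a}" "\<lambda>k. \<sigma> (a, k)"] X
          measure_PiM_bernoulli_atom[of "{b..c - a}" "\<lambda>_. p" "\<lambda>k. \<sigma> (a, k)"]
        by (simp add: bernoulli_field_def)
      moreover have "agreement M X ?B \<sigma> = {\<omega> \<in> space M. \<forall>k\<in>{b..c - a}. X a k \<omega> = \<sigma> (a, k)}"
        by (simp only: triangle_base_def agreement_row)
      moreover have "(\<Prod>s\<in>?B. pmf (bernoulli_pmf p) (\<sigma> s)) = (\<Prod>k\<in>{b..c - a}. pmf (bernoulli_pmf p) (\<sigma> (a, k)))"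
        by (rule prod.reindex_bij_witness[of _ "\<lambda>k. (a, k)" snd]) (auto simp: triangle_base_def)
      ultimately show ?thesis by simp
    qed
    moreover have "V a = {}" by (auto simp: V_def)
    ultimately show ?case by (simp add: region_law_def region_weight_def)
  next
    case (step m)
    let ?J = "{b..c - m - 1}"
    have V_step: "V (m + 1) = V m \<union> {m + 1} \<times> ?J"
      using step.hyps by (auto simp: V_def)
    show ?case
      unfolding region_law_def
    proof
      fix \<sigma> :: "int \<times> int \<Rightarrow> bool"
      let ?A = "agreement M X (?B \<union> V m) \<sigma>"
      let ?w = "\<Prod>j\<in>?J. pmf (bernoulli_pmf (\<theta> (\<sigma> (m, j)) (\<sigma> (m, j + 1)))) (\<sigma> (m + 1, j))"
      have A: "?A \<in> sets (past M X m)"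
        using V_fin step.hyps by (intro past_sets) (auto simp: V_def triangle_base_def)
      have "agreement M X (?B \<union> V (m + 1)) \<sigma>
          = ?A \<inter> {\<omega> \<in> space M. \<forall>j\<in>?J. X (m + 1) j \<omega> = \<sigma> (m + 1, j)}"
        unfolding V_step agreement_row[symmetric] agreement_Un by (rule Int_assoc[symmetric])
      then have "measure M (agreement M X (?B \<union> V (m + 1)) \<sigma>)
          = (\<integral>\<omega>. indicator ?A \<omega> * (\<Prod>j\<in>?J. pmf (bernoulli_pmf (\<theta> (X m j \<omega>) (X m (j + 1) \<omega>))) (\<sigma> (m + 1, j))) \<partial>M)"
        using stationary_diagram_one_step[OF range diagram _ A, of ?J "\<lambda>j. \<sigma> (m + 1, j)"] by simp
      also have "\<dots> = (\<integral>\<omega>. indicator ?A \<omega> * ?w \<partial>M)"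
      proof (rule Bochner_Integration.integral_cong[OF refl])
        fix \<omega>
        have row: "(m, j) \<in> ?B \<union> V m" if "j \<in> {b..c - m}" for j
          using that step.hyps by (auto simp: V_def triangle_base_def)
        have "X m j \<omega> = \<sigma> (m, j)" if "\<omega> \<in> ?A" "j \<in> {b..c - m}" for j
          using agreementD[OF that(1) row[OF that(2)]] .
        then show "indicator ?A \<omega> * (\<Prod>j\<in>?J. pmf (bernoulli_pmf (\<theta> (X m j \<omega>) (X m (j + 1) \<omega>))) (\<sigma> (m + 1, j)))
            = indicator ?A \<omega> * ?w"
          by (cases "\<omega> \<in> ?A") (auto intro!: prod.cong)
      qed
      also have "\<dots> = measure M ?A * ?w"
        using sets.sets_into_space[OF agreement_sets[of "?B \<union> V m" X M \<sigma>]] V_fin X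
        by (simp add: Int_absorb2)
      also have "\<dots> = region_weight \<theta> p ?B (V m) \<sigma> * (\<Prod>s\<in>{m + 1} \<times> ?J. update_prob \<theta> \<sigma> s)"
      proof -
        have "(\<Prod>s\<in>{m + 1} \<times> ?J. update_prob \<theta> \<sigma> s) = ?w"
          by (rule prod.reindex_bij_witness[of _ "\<lambda>k. (m + 1, k)" snd]) (auto simp: update_prob_def)
        then show ?thesis using step.IH by (simp add: region_law_def)
      qed
      also have "\<dots> = region_weight \<theta> p ?B (V (m + 1)) \<sigma>"
        unfolding region_weight_def V_step using V_fin[of m]
        by (subst prod.union_disjoint) (auto simp: V_def)
      finally show "measure M (agreement M X (?B \<union> V (m + 1)) \<sigma>) = region_weight \<theta> p ?B (V (m + 1)) \<sigma>" .
    qed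
  qed
  \<comment> \<open>The highest row is \<open>c - b\<close>; the maximum covers triangles without upper sites.\<close>
  have "V (max a (c - b)) = triangle_upper a b c"
    by (auto simp: V_def triangle_upper_def)
  then show "region_law \<theta> p M X ?B (triangle_upper a b c)"
    using rows[of "max a (c - b)"] by simp
qed

section \<open>The triangle law determines the diagram\<close>

text \<open>
  Since triangles are cofinal among the finite sets of sites, their atoms determine the law of the
  field.
\<close>

lemma triangle_law_unique:
  fixes M :: "'a measure" and N :: "'b measure"
  assumes "prob_space M" and X: "\<And>n k. X n k \<in> measurable M (count_space UNIV)"
    and "prob_space N" and Y: "\<And>n k. Y n k \<in> measurable N (count_space UNIV)"
    and "triangle_law \<theta> p M X" and "triangle_law \<theta> p N Y"
  shows "field_law M X = field_law N Y"
proof (rule measure_eqI_binary_atoms[where I = UNIV])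
  interpret M: prob_space M by fact
  interpret N: prob_space N by fact
  let ?P = "PiM UNIV (\<lambda>_. count_space UNIV) :: (int \<times> int \<Rightarrow> bool) measure"
  have law: "field_law M X = distr M ?P (\<lambda>\<omega> s. X (fst s) (snd s) \<omega>)"
      "field_law N Y = distr N ?P (\<lambda>\<omega> s. Y (fst s) (snd s) \<omega>)"
    by (simp_all add: field_law_def case_prod_unfold)
  show "finite_measure (field_law M X)" "finite_measure (field_law N Y)"
    unfolding law using X Y
    by (auto intro!: M.finite_measure_distr N.finite_measure_distr random_field_measurable)
  fix F :: "(int \<times> int) set" assume "finite F"
  then obtain a b c where F: "F \<subseteq> {(n, k). a \<le> n \<and> b \<le> k \<and> n + k \<le> c}"
    using finite_sites_in_triangle[where F = F and h = 0] by metis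
  let ?R = "triangle_base a b c \<union> triangle_upper a b c"
  have "measure (field_law M X) {x. \<forall>s\<in>?R. x s = \<sigma> s} = measure (field_law N Y) {x. \<forall>s\<in>?R. x s = \<sigma> s}" for \<sigma>
    unfolding law using assms(5,6) X Y
    by (simp add: measure_distr_atom triangle_law_def region_law_def agreement_def)
  then show "\<exists>J. finite J \<and> F \<subseteq> J \<and> J \<subseteq> UNIV \<and>
      (\<forall>\<sigma>. measure (field_law M X) {x \<in> space (field_law M X). \<forall>j\<in>J. x j = \<sigma> j}
        = measure (field_law N Y) {x \<in> space (field_law N Y). \<forall>j\<in>J. x j = \<sigma> j})"
    using F unfolding triangle_base_Un_upper[symmetric]
    by (intro exI[of _ ?R]) (simp add: law space_PiM)
qed (simp_all add: field_law_def)

text \<open>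
  A row segment is the base of a triangle; all other sites of the triangle are summed out.
\<close>

lemma triangle_law_row:
  assumes "prob_space M" and X: "\<And>n k. X n k \<in> measurable M (count_space UNIV)"
    and law: "triangle_law \<theta> p M X"
  shows "distr M (PiM UNIV (\<lambda>_. count_space UNIV)) (\<lambda>\<omega> k. X n k \<omega>) = bernoulli_field p"
proof (rule measure_eqI_binary_atoms[where I = UNIV])
  interpret prob_space M by fact
  show "finite_measure (distr M (PiM UNIV (\<lambda>_. count_space UNIV)) (\<lambda>\<omega> k. X n k \<omega>))"
    by (rule finite_measure_distr[OF random_field_measurable[OF X]])
  show "finite_measure (bernoulli_field p)"
    unfolding bernoulli_field_def
    using prob_space_PiM_bernoulli by (rule prob_space.finite_measure)
  fix F :: "int set" assume F: "finite F"
  \<comment> \<open>The inserted \<open>0\<close> makes the extrema defined when \<open>F\<close> is empty.\<close>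
  define b d where "b = Min (insert 0 F)" and "d = Max (insert 0 F)"
  let ?B = "triangle_base n b (n + d)"
  have "region_law \<theta> p M X ?B (triangle_upper n b (n + d))"
    using law by (simp add: triangle_law_def)
  then have "region_law \<theta> p M X ?B {}"
    by (rule region_law_marginal[OF finite_measure_axioms X _ finite_triangle_base finite_triangle_upper])
      (auto simp: triangle_base_def triangle_upper_def)
  then have "measure M (agreement M X ?B (\<lambda>(n, k). \<sigma> k)) = (\<Prod>s\<in>?B. pmf (bernoulli_pmf p) (\<sigma> (snd s)))" for \<sigma>
    by (simp add: region_law_def region_weight_def case_prod_unfold)
  moreover have "agreement M X ?B (\<lambda>(n, k). \<sigma> k) = {\<omega> \<in> space M. \<forall>k\<in>{b..d}. X n k \<omega> = \<sigma> k}" for \<sigma>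
    by (simp add: triangle_base_def agreement_row)
  moreover have "(\<Prod>s\<in>?B. pmf (bernoulli_pmf p) (\<sigma> (snd s))) = (\<Prod>k\<in>{b..d}. pmf (bernoulli_pmf p) (\<sigma> k))" for \<sigma>
    by (rule prod.reindex_bij_witness[of _ "\<lambda>k. (n, k)" snd]) (auto simp: triangle_base_def)
  ultimately have "measure (distr M (PiM UNIV (\<lambda>_. count_space UNIV)) (\<lambda>\<omega> k. X n k \<omega>)) {x. \<forall>j\<in>{b..d}. x j = \<sigma> j}
      = measure (bernoulli_field p) {x. \<forall>j\<in>{b..d}. x j = \<sigma> j}" for \<sigma>
    unfolding bernoulli_field_def
    using measure_distr_atom[of "X n" M "{b..d}" \<sigma>] X measure_PiM_bernoulli_atom[of "{b..d}" "\<lambda>_. p" \<sigma>]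
    by simp
  moreover have "F \<subseteq> {b..d}" using F by (auto simp: b_def d_def)
  ultimately show "\<exists>J. finite J \<and> F \<subseteq> J \<and> J \<subseteq> UNIV \<and>
      (\<forall>\<sigma>. measure (distr M (PiM UNIV (\<lambda>_. count_space UNIV)) (\<lambda>\<omega> k. X n k \<omega>))
          {x \<in> space (distr M (PiM UNIV (\<lambda>_. count_space UNIV)) (\<lambda>\<omega> k. X n k \<omega>)). \<forall>j\<in>J. x j = \<sigma> j}
        = measure (bernoulli_field p) {x \<in> space (bernoulli_field p). \<forall>j\<in>J. x j = \<sigma> j})"
    by (intro exI[of _ "{b..d}"]) (simp add: space_PiM bernoulli_field_def)
qed (simp_all add: bernoulli_field_def sets_PiM_bernoulli)

text \<open>
  The past is an atom on a triangle truncated above row \<open>n\<close>.  Adding the sites \<open>J\<close> of the next row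
  multiplies its weight by one factor for each of them.
\<close>

lemma triangle_law_one_step_atom:
  assumes "prob_space M" and X: "\<And>n k. X n k \<in> measurable M (count_space UNIV)"
    and law: "triangle_law \<theta> p M X" and J: "finite J"
    and A: "A = agreement M X {(m, k). a \<le> m \<and> m \<le> n \<and> b \<le> k \<and> m + k \<le> c} \<sigma>"
    and J_sub: "J \<subseteq> {b..c - n - 1}" and an: "a \<le> n"
  shows "measure M (A \<inter> {\<omega> \<in> space M. \<forall>j\<in>J. X (n + 1) j \<omega> \<in> B j})
    = measure M A * (\<Prod>j\<in>J. measure_pmf.prob (bernoulli_pmf (\<theta> (\<sigma> (n, j)) (\<sigma> (n, j + 1)))) (B j))"
proof -
  interpret prob_space M by fact
  let ?Base = "triangle_base a b c"
  define V where "V = {(m, k). a < m \<and> m \<le> n \<and> b \<le> k \<and> m + k \<le> c}"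
  have V_fin: "finite V"
    by (rule finite_subset[OF _ finite_triangle_upper[of a b c]]) (auto simp: V_def triangle_upper_def)
  have A': "A = agreement M X (?Base \<union> V) \<sigma>"
    unfolding A by (rule arg_cong[where f = "\<lambda>R. agreement M X R \<sigma>"]) (use an in \<open>auto simp: triangle_base_def V_def\<close>)
  have tri: "region_law \<theta> p M X ?Base (triangle_upper a b c)"
    using law by (simp add: triangle_law_def)
  have lawV: "region_law \<theta> p M X ?Base V"
    by (rule region_law_marginal[OF finite_measure_axioms X tri finite_triangle_base finite_triangle_upper])
      (auto simp: V_def triangle_base_def triangle_upper_def)
  have lawVJ: "region_law \<theta> p M X ?Base (V \<union> {n + 1} \<times> J)"
    by (rule region_law_marginal[OF finite_measure_axioms X tri finite_triangle_base finite_triangle_upper])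
      (use J_sub an in \<open>auto simp: V_def triangle_base_def triangle_upper_def\<close>)
  have atom: "measure M (A \<inter> {\<omega> \<in> space M. \<forall>j\<in>J. X (n + 1) j \<omega> = g j})
      = measure M A * (\<Prod>j\<in>J. pmf (bernoulli_pmf (\<theta> (\<sigma> (n, j)) (\<sigma> (n, j + 1)))) (g j))" for g
  proof -
    \<comment> \<open>The configuration of the past together with the values \<open>g\<close> of the next row.\<close>
    define \<tau> where "\<tau> = (\<lambda>(m, k). if m = n + 1 then g k else \<sigma> (m, k))"
    have \<tau>: "\<tau> (m, k) = \<sigma> (m, k)" if "m \<le> n" for m k using that by (simp add: \<tau>_def)
    have "A \<inter> {\<omega> \<in> space M. \<forall>j\<in>J. X (n + 1) j \<omega> = g j}
        = agreement M X (?Base \<union> (V \<union> {n + 1} \<times> J)) \<tau>"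
    proof -
      have "A = agreement M X (?Base \<union> V) \<tau>"
        unfolding A' using an by (intro agreement_cong) (auto simp: V_def triangle_base_def \<tau>)
      moreover have "{\<omega> \<in> space M. \<forall>j\<in>J. X (n + 1) j \<omega> = g j} = agreement M X ({n + 1} \<times> J) \<tau>"
        by (simp add: agreement_row \<tau>_def)
      ultimately show ?thesis by (simp only: agreement_Un Int_assoc)
    qed
    then have "measure M (A \<inter> {\<omega> \<in> space M. \<forall>j\<in>J. X (n + 1) j \<omega> = g j})
        = region_weight \<theta> p ?Base (V \<union> {n + 1} \<times> J) \<tau>"
      using lawVJ by (simp add: region_law_def)
    also have "\<dots> = region_weight \<theta> p ?Base V \<tau> * (\<Prod>s\<in>{n + 1} \<times> J. update_prob \<theta> \<tau> s)"
      unfolding region_weight_def using V_fin J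
      by (subst prod.union_disjoint) (auto simp: V_def)
    also have "region_weight \<theta> p ?Base V \<tau> = region_weight \<theta> p ?Base V \<sigma>"
      unfolding region_weight_def using an
      by (intro arg_cong2[where f = "(*)"] prod.cong refl)
        (auto simp: update_prob_def V_def triangle_base_def \<tau>)
    also have "\<dots> = measure M A"
      using lawV by (simp add: region_law_def A')
    also have "(\<Prod>s\<in>{n + 1} \<times> J. update_prob \<theta> \<tau> s)
        = (\<Prod>j\<in>J. pmf (bernoulli_pmf (\<theta> (\<sigma> (n, j)) (\<sigma> (n, j + 1)))) (g j))"
      by (rule prod.reindex_bij_witness[of _ "\<lambda>k. (n + 1, k)" snd]) (auto simp: update_prob_def \<tau>_def)
    finally show ?thesis .
  qed
  have AM: "A \<in> sets M" unfolding A' using V_fin X by (intro agreement_sets) auto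
  have "measure M (A \<inter> {\<omega> \<in> space M. \<forall>j\<in>J. X (n + 1) j \<omega> \<in> B j})
      = (\<Sum>g\<in>PiE J B. measure M A * (\<Prod>j\<in>J. pmf (bernoulli_pmf (\<theta> (\<sigma> (n, j)) (\<sigma> (n, j + 1)))) (g j)))"
    by (subst measure_cylinder_eq_sum_atoms[OF J AM X]) (simp only: atom)
  also have "\<dots> = measure M A * (\<Prod>j\<in>J. \<Sum>v\<in>B j. pmf (bernoulli_pmf (\<theta> (\<sigma> (n, j)) (\<sigma> (n, j + 1)))) v)"
    unfolding sum_distrib_left[symmetric] by (subst prod_sum_PiE[OF J]) auto
  finally show ?thesis
    by (simp add: measure_measure_pmf_finite)
qed

text \<open>
  From atoms to all events of the past, by \<open>integral_generated_algebra_eqI\<close>: truncated triangles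
  are cofinal among the finite sets of sites of the past.
\<close>

lemma triangle_law_one_step:
  assumes "prob_space M" and X: "\<And>n k. X n k \<in> measurable M (count_space UNIV)"
    and law: "triangle_law \<theta> p M X" and J: "finite J" and A: "A \<in> sets (past M X n)"
  shows "measure M (A \<inter> {\<omega> \<in> space M. \<forall>j\<in>J. X (n + 1) j \<omega> \<in> B j})
    = (\<integral>\<omega>. indicator A \<omega> * (\<Prod>j\<in>J. measure_pmf.prob (bernoulli_pmf (\<theta> (X n j \<omega>) (X n (j + 1) \<omega>))) (B j)) \<partial>M)"
proof -
  interpret prob_space M by fact
  let ?E = "{\<omega> \<in> space M. \<forall>j\<in>J. X (n + 1) j \<omega> \<in> B j}"
  let ?\<kappa> = "\<lambda>\<omega>. \<Prod>j\<in>J. measure_pmf.prob (bernoulli_pmf (\<theta> (X n j \<omega>) (X n (j + 1) \<omega>))) (B j)"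
  have E [measurable]: "?E \<in> sets M" using J X by (intro sets_binary_atom) auto
  have ind: "measure M (A \<inter> ?E) = (\<integral>\<omega>. indicator A \<omega> * indicator ?E \<omega> \<partial>M)" for A
  proof -
    have "A \<inter> ?E \<inter> space M = A \<inter> ?E" by auto
    then show ?thesis by (simp add: indicator_inter_arith[symmetric])
  qed
  have \<kappa>_meas: "?\<kappa> \<in> borel_measurable M"
    by (intro borel_measurable_prod measurable_two_bits X)
  have \<kappa>_bounds: "0 \<le> ?\<kappa> \<omega>" "?\<kappa> \<omega> \<le> 1" for \<omega>
    by (auto intro!: prod_nonneg prod_le_1)
  have "(\<integral>\<omega>. indicator A \<omega> * indicator ?E \<omega> \<partial>M) = (\<integral>\<omega>. indicator A \<omega> * ?\<kappa> \<omega> \<partial>M)"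
  proof (rule integral_generated_algebra_eqI[OF finite_measure_axioms _ _ _ _ _ _ A])
    show "integrable M ?\<kappa>"
      by (rule integrable_const_bound[of _ 1, OF _ \<kappa>_meas]) (use \<kappa>_bounds in auto)
    show "integrable M (indicator ?E :: _ \<Rightarrow> real)"
      by (simp add: integrable_indicator_iff emeasure_eq_measure)
    fix F :: "(int \<times> int) set" assume F: "finite F" "F \<subseteq> {..n} \<times> UNIV"
    \<comment> \<open>A triangle that contains the children \<open>J\<close> on row \<open>n + 1\<close> also contains their parents on row \<open>n\<close>.\<close>
    have "finite (F \<union> {n + 1} \<times> J)" using F J by auto
    from finite_sites_in_triangle[OF this, of n] obtain a b c
      where tri: "F \<union> {n + 1} \<times> J \<subseteq> {(m, k). a \<le> m \<and> b \<le> k \<and> m + k \<le> c}" and an: "a \<le> n" .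
    let ?R = "{(m, k). a \<le> m \<and> m \<le> n \<and> b \<le> k \<and> m + k \<le> c}"
    have J_sub: "J \<subseteq> {b..c - n - 1}"
    proof
      fix j assume "j \<in> J"
      then have "(n + 1, j) \<in> {(m, k). a \<le> m \<and> b \<le> k \<and> m + k \<le> c}" using tri by blast
      then show "j \<in> {b..c - n - 1}" by simp
    qed
    have R_fin: "finite ?R"
      by (rule finite_subset[of _ "{a..c - b} \<times> {b..c - a}"]) auto
    have "(\<integral>\<omega>. indicator A \<omega> * indicator ?E \<omega> \<partial>M) = (\<integral>\<omega>. indicator A \<omega> * ?\<kappa> \<omega> \<partial>M)"
      if A: "A = agreement M X ?R \<sigma>" for A \<sigma>
    proof -
      let ?w = "\<Prod>j\<in>J. measure_pmf.prob (bernoulli_pmf (\<theta> (\<sigma> (n, j)) (\<sigma> (n, j + 1)))) (B j)"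
      have "(\<integral>\<omega>. indicator A \<omega> * ?\<kappa> \<omega> \<partial>M) = (\<integral>\<omega>. indicator A \<omega> * ?w \<partial>M)"
      proof (rule Bochner_Integration.integral_cong[OF refl])
        fix \<omega>
        have row: "(n, j) \<in> ?R" if "j \<in> {b..c - n}" for j
          using that an by auto
        have "X n j \<omega> = \<sigma> (n, j)" if "\<omega> \<in> A" "j \<in> {b..c - n}" for j
          using agreementD[OF that(1)[unfolded A] row[OF that(2)]] .
        moreover have "j \<in> {b..c - n}" "j + 1 \<in> {b..c - n}" if "j \<in> J" for j
          using that J_sub by auto
        ultimately show "indicator A \<omega> * ?\<kappa> \<omega> = indicator A \<omega> * ?w"
          by (cases "\<omega> \<in> A") (auto intro!: prod.cong)
      qed
      also have "\<dots> = measure M A * ?w"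
        using sets.sets_into_space[OF agreement_sets[where X = X and \<sigma> = \<sigma>, OF R_fin X]]
        by (simp add: A Int_absorb2)
      also have "\<dots> = measure M (A \<inter> ?E)"
        by (rule triangle_law_one_step_atom[OF \<open>prob_space M\<close> X law J A J_sub an, symmetric])
      finally show ?thesis by (simp add: ind)
    qed
    then have "\<forall>\<sigma>. let A = {\<omega> \<in> space M. \<forall>s\<in>?R. (\<lambda>(m, k). X m k) s \<omega> = \<sigma> s} in
        (\<integral>\<omega>. indicator A \<omega> * indicator ?E \<omega> \<partial>M) = (\<integral>\<omega>. indicator A \<omega> * ?\<kappa> \<omega> \<partial>M)"
      by (simp add: Let_def agreement_def case_prod_unfold)
    moreover have "F \<subseteq> ?R" using F tri by auto
    ultimately show "\<exists>R. finite R \<and> F \<subseteq> R \<and> R \<subseteq> {..n} \<times> UNIV \<and>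
        (\<forall>\<sigma>. let A = {\<omega> \<in> space M. \<forall>s\<in>R. (\<lambda>(m, k). X m k) s \<omega> = \<sigma> s} in
          (\<integral>\<omega>. indicator A \<omega> * indicator ?E \<omega> \<partial>M) = (\<integral>\<omega>. indicator A \<omega> * ?\<kappa> \<omega> \<partial>M))"
      using R_fin by (intro exI[of _ ?R] conjI) auto
  qed (use X \<kappa>_bounds in auto)
  then show ?thesis by (simp only: ind)
qed

text \<open>
  The one-step probabilities depend on row \<open>n\<close> only, so they are the conditional probabilities
  given any \<open>\<sigma>\<close>-algebra between the one of row \<open>n\<close> and the past.  Both ends matter: the past for the
  definition of a diagram, row \<open>n\<close> alone for the conditional law of one line given its neighbour.
\<close>

lemma triangle_law_conditional:
  assumes "prob_space M" and X: "\<And>n k. X n k \<in> measurable M (count_space UNIV)"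
    and law: "triangle_law \<theta> p M X" and range: "\<And>x y. 0 \<le> \<theta> x y \<and> \<theta> x y \<le> 1"
    and space: "space G = space M" and sub: "sets G \<subseteq> sets (past M X n)"
    and row: "\<And>k. X n k \<in> measurable G (count_space UNIV)"
  shows "cond_indep_vars M G (X (n + 1)) UNIV \<and>
    (\<forall>k. AE \<omega> in M. cprob M G (X (n + 1) k) \<omega> = \<theta> (X n k \<omega>) (X n (k + 1) \<omega>))"
proof -
  interpret prob_space M by fact
  have pastM: "sets (past M X n) \<subseteq> sets M"
    using past_subalgebra[OF X] by (auto simp: subalgebra_def)
  interpret G: finite_measure_subalgebra M G
    by unfold_locales (use space sub pastM in \<open>auto simp: subalgebra_def\<close>)
  let ?\<kappa> = "\<lambda>j B \<omega>. measure_pmf.prob (bernoulli_pmf (\<theta> (X n j \<omega>) (X n (j + 1) \<omega>))) B"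
  have joint: "AE \<omega> in M. cprob M G (\<lambda>\<omega>. \<forall>j\<in>J. X (n + 1) j \<omega> \<in> B j) \<omega> = (\<Prod>j\<in>J. ?\<kappa> j (B j) \<omega>)"
    if J: "finite J" for J B
    unfolding cprob_def
  proof (rule G.real_cond_exp_charact)
    let ?E = "{\<omega> \<in> space M. \<forall>j\<in>J. X (n + 1) j \<omega> \<in> B j}"
    have E [measurable]: "?E \<in> sets M" using J X by (intro sets_binary_atom) auto
    show "integrable M (indicator ?E :: _ \<Rightarrow> real)"
      by (simp add: integrable_indicator_iff emeasure_eq_measure)
    show \<kappa>_meas: "(\<lambda>\<omega>. \<Prod>j\<in>J. ?\<kappa> j (B j) \<omega>) \<in> borel_measurable G"
      by (intro borel_measurable_prod measurable_two_bits row)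
    then have "(\<lambda>\<omega>. \<Prod>j\<in>J. ?\<kappa> j (B j) \<omega>) \<in> borel_measurable M"
      by (rule measurable_from_subalg[OF G.subalg])
    then show "integrable M (\<lambda>\<omega>. \<Prod>j\<in>J. ?\<kappa> j (B j) \<omega>)"
      by (rule integrable_const_bound[of _ 1, rotated]) (auto intro!: AE_I2 prod_nonneg prod_le_1 simp: abs_prod)
    fix A assume "A \<in> sets G"
    then have A: "A \<in> sets (past M X n)" using sub by auto
    have "A \<inter> ?E \<inter> space M = A \<inter> ?E" by auto
    then have "(\<integral>\<omega>\<in>A. indicator ?E \<omega> \<partial>M) = measure M (A \<inter> ?E)"
      by (simp add: set_lebesgue_integral_def indicator_inter_arith[symmetric])
    also have "\<dots> = (\<integral>\<omega>\<in>A. (\<Prod>j\<in>J. ?\<kappa> j (B j) \<omega>) \<partial>M)"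
      unfolding triangle_law_one_step[OF \<open>prob_space M\<close> X law J A] by (simp add: set_lebesgue_integral_def)
    finally show "(\<integral>\<omega>\<in>A. indicator ?E \<omega> \<partial>M) = (\<integral>\<omega>\<in>A. (\<Prod>j\<in>J. ?\<kappa> j (B j) \<omega>) \<partial>M)" .
  qed
  have single: "AE \<omega> in M. cprob M G (\<lambda>\<omega>. X (n + 1) j \<omega> \<in> B) \<omega> = ?\<kappa> j B \<omega>" for j B
    using joint[of "{j}" "\<lambda>_. B"] by simp
  have "cond_indep_vars M G (X (n + 1)) UNIV"
    unfolding cond_indep_vars_def
  proof (intro allI impI)
    fix J :: "int set" and B assume J: "finite J"
    have "AE \<omega> in M. \<forall>j\<in>J. cprob M G (\<lambda>\<omega>. X (n + 1) j \<omega> \<in> B j) \<omega> = ?\<kappa> j (B j) \<omega>"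
      using J by (rule AE_finite_allI) (rule single)
    with joint[OF J, of B] show "AE \<omega> in M. cprob M G (\<lambda>\<omega>'. \<forall>j\<in>J. X (n + 1) j \<omega>' \<in> B j) \<omega>
        = (\<Prod>j\<in>J. cprob M G (\<lambda>\<omega>'. X (n + 1) j \<omega>' \<in> B j) \<omega>)"
      by eventually_elim simp
  qed
  moreover have "AE \<omega> in M. cprob M G (X (n + 1) k) \<omega> = \<theta> (X n k \<omega>) (X n (k + 1) \<omega>)" for k
    using single[of k "{True}"] range by (simp add: measure_pmf_single)
  ultimately show ?thesis by blast
qed

lemma triangle_law_stationary_diagram:
  assumes "prob_space M" and X: "\<And>n k. X n k \<in> measurable M (count_space UNIV)"
    and law: "triangle_law \<theta> p M X" and range: "\<And>x y. 0 \<le> \<theta> x y \<and> \<theta> x y \<le> 1"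
  shows "stationary_diagram \<theta> p M X"
  unfolding stationary_diagram_def Let_def
  using assms(1) X triangle_law_row[OF assms(1) X law]
    triangle_law_conditional[OF assms(1) X law range space_generated_algebra order_refl past_row_measurable]
  by blast

section \<open>Invariance of the Bernoulli measure\<close>

lemma sum_PiE_insert:
  assumes "x \<notin> S"
  shows "sum F (PiE (insert x S) T) = (\<Sum>y\<in>T x. \<Sum>g\<in>PiE S T. F (g(x := y)))"
  unfolding PiE_insert_eq sum.cartesian_product
  by (subst sum.reindex[OF inj_combinator[OF assms]]) (simp add: case_prod_unfold)

text \<open>
  A row \<open>x b, \<dots>, x d\<close> with a prescribed right neighbour \<open>v\<close> of its last cell produces a
  Bernoulli row, whatever \<open>v\<close> is.  Fixing \<open>v\<close> makes the induction possible: when the segment grows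
  by one cell, the value of the new cell becomes the prescribed neighbour of the old segment.
\<close>

lemma sum_chain_bernoulli:
  fixes b d :: int
  assumes stationary: "\<And>x y. (\<Sum>u\<in>UNIV. pmf (bernoulli_pmf p) u * pmf (bernoulli_pmf (\<theta> u x)) y)
      = pmf (bernoulli_pmf p) y"
    and "b - 1 \<le> d"
  shows "(\<Sum>x\<in>PiE {b..d} (\<lambda>_. UNIV). \<Prod>k\<in>{b..d}. pmf (bernoulli_pmf p) (x k)
        * pmf (bernoulli_pmf (\<theta> (x k) (if k = d then v else x (k + 1)))) (\<sigma> k))
    = (\<Prod>k\<in>{b..d}. pmf (bernoulli_pmf p) (\<sigma> k))"
  using \<open>b - 1 \<le> d\<close>
proof (induction d arbitrary: v rule: int_ge_induct)
  case base
  then show ?case by simp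
next
  case (step d)
  let ?w = "\<lambda>v d x. (\<Prod>k\<in>{b..d}. pmf (bernoulli_pmf p) (x k)
        * pmf (bernoulli_pmf (\<theta> (x k) (if k = d then v else x (k + 1)))) (\<sigma> k))"
  have ins: "{b..d + 1} = insert (d + 1) {b..d}" using step.hyps by auto
  have w: "?w v (d + 1) (x(d + 1 := y))
      = pmf (bernoulli_pmf p) y * pmf (bernoulli_pmf (\<theta> y v)) (\<sigma> (d + 1)) * ?w y d x" for x y
  proof -
    have "?w v (d + 1) (x(d + 1 := y))
        = pmf (bernoulli_pmf p) y * pmf (bernoulli_pmf (\<theta> y v)) (\<sigma> (d + 1))
          * (\<Prod>k\<in>{b..d}. pmf (bernoulli_pmf p) ((x(d + 1 := y)) k)
            * pmf (bernoulli_pmf (\<theta> ((x(d + 1 := y)) k)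
                (if k = d + 1 then v else (x(d + 1 := y)) (k + 1)))) (\<sigma> k))"
      unfolding ins by (subst prod.insert) auto
    also have "(\<Prod>k\<in>{b..d}. pmf (bernoulli_pmf p) ((x(d + 1 := y)) k)
            * pmf (bernoulli_pmf (\<theta> ((x(d + 1 := y)) k)
                (if k = d + 1 then v else (x(d + 1 := y)) (k + 1)))) (\<sigma> k)) = ?w y d x"
      by (rule prod.cong) auto
    finally show ?thesis .
  qed
  have "sum (?w v (d + 1)) (PiE {b..d + 1} (\<lambda>_. UNIV))
      = (\<Sum>y\<in>UNIV. \<Sum>x\<in>PiE {b..d} (\<lambda>_. UNIV). ?w v (d + 1) (x(d + 1 := y)))"
    unfolding ins by (rule sum_PiE_insert) simp
  also have "\<dots> = (\<Sum>y\<in>UNIV. pmf (bernoulli_pmf p) y * pmf (bernoulli_pmf (\<theta> y v)) (\<sigma> (d + 1))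
      * (\<Sum>x\<in>PiE {b..d} (\<lambda>_. UNIV). ?w y d x))"
    unfolding w sum_distrib_left ..
  also have "\<dots> = (\<Sum>y\<in>UNIV. pmf (bernoulli_pmf p) y * pmf (bernoulli_pmf (\<theta> y v)) (\<sigma> (d + 1)))
      * (\<Prod>k\<in>{b..d}. pmf (bernoulli_pmf p) (\<sigma> k))"
    unfolding step.IH sum_distrib_right ..
  also have "\<dots> = (\<Prod>k\<in>{b..d + 1}. pmf (bernoulli_pmf p) (\<sigma> k))"
    unfolding stationary ins by simp
  finally show ?case .
qed

lemma sum_row_bernoulli:
  fixes b d :: int
  assumes stationary: "\<And>x y. (\<Sum>u\<in>UNIV. pmf (bernoulli_pmf p) u * pmf (bernoulli_pmf (\<theta> u x)) y)
      = pmf (bernoulli_pmf p) y"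
    and "b - 1 \<le> d"
  shows "(\<Sum>x\<in>PiE {b..d + 1} (\<lambda>_. UNIV). (\<Prod>k\<in>{b..d + 1}. pmf (bernoulli_pmf p) (x k))
        * (\<Prod>k\<in>{b..d}. pmf (bernoulli_pmf (\<theta> (x k) (x (k + 1)))) (\<sigma> k)))
    = (\<Prod>k\<in>{b..d}. pmf (bernoulli_pmf p) (\<sigma> k))"
proof -
  let ?F = "\<lambda>x. (\<Prod>k\<in>{b..d + 1}. pmf (bernoulli_pmf p) (x k))
        * (\<Prod>k\<in>{b..d}. pmf (bernoulli_pmf (\<theta> (x k) (x (k + 1)))) (\<sigma> k))"
  let ?w = "\<lambda>v x. (\<Prod>k\<in>{b..d}. pmf (bernoulli_pmf p) (x k)
        * pmf (bernoulli_pmf (\<theta> (x k) (if k = d then v else x (k + 1)))) (\<sigma> k))"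
  have ins: "{b..d + 1} = insert (d + 1) {b..d}" using \<open>b - 1 \<le> d\<close> by auto
  have F: "?F (x(d + 1 := v)) = pmf (bernoulli_pmf p) v * ?w v x" for x v
  proof -
    have "(\<Prod>k\<in>{b..d + 1}. pmf (bernoulli_pmf p) ((x(d + 1 := v)) k))
        = pmf (bernoulli_pmf p) v * (\<Prod>k\<in>{b..d}. pmf (bernoulli_pmf p) (x k))"
      unfolding ins by (subst prod.insert) (auto intro!: prod.cong)
    moreover have "(\<Prod>k\<in>{b..d}. pmf (bernoulli_pmf (\<theta> ((x(d + 1 := v)) k) ((x(d + 1 := v)) (k + 1)))) (\<sigma> k))
        = (\<Prod>k\<in>{b..d}. pmf (bernoulli_pmf (\<theta> (x k) (if k = d then v else x (k + 1)))) (\<sigma> k))"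
      by (rule prod.cong) auto
    ultimately show ?thesis by (simp add: prod.distrib)
  qed
  have "sum ?F (PiE {b..d + 1} (\<lambda>_. UNIV))
      = (\<Sum>v\<in>UNIV. \<Sum>x\<in>PiE {b..d} (\<lambda>_. UNIV). ?F (x(d + 1 := v)))"
    unfolding ins by (rule sum_PiE_insert) simp
  also have "\<dots> = (\<Sum>v\<in>UNIV. pmf (bernoulli_pmf p) v * (\<Sum>x\<in>PiE {b..d} (\<lambda>_. UNIV). ?w v x))"
    unfolding F sum_distrib_left ..
  also have "\<dots> = (\<Sum>v\<in>UNIV. pmf (bernoulli_pmf p) v) * (\<Prod>k\<in>{b..d}. pmf (bernoulli_pmf p) (\<sigma> k))"
    unfolding sum_distrib_right
    by (intro sum.cong refl arg_cong2[where f = "(*)"] sum_chain_bernoulli stationary \<open>b - 1 \<le> d\<close>)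
  finally show ?thesis by (simp add: sum_pmf_eq_1)
qed

text \<open>
  On a cylinder the kernel is a finite product of functions of two bits each.
\<close>

lemma pca_kernel_measurable:
  "pca_kernel \<theta> \<in> measurable (bernoulli_field p) (prob_algebra (PiM UNIV (\<lambda>_. count_space UNIV)))"
proof (rule measurable_prob_algebra_generated[OF sets_PiM Int_stable_prod_algebra prod_algebra_sets_into_space])
  show "prob_space (pca_kernel \<theta> x)" for x
    unfolding pca_kernel_def by (rule prob_space_PiM_bernoulli)
  show "sets (pca_kernel \<theta> x) = sets (PiM UNIV (\<lambda>_. count_space UNIV))" for x
    unfolding pca_kernel_def by (rule sets_PiM_bernoulli)
  fix A :: "(int \<Rightarrow> bool) set"
  assume "A \<in> prod_algebra UNIV (\<lambda>_. count_space UNIV)"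
  then obtain J E where A: "A = prod_emb UNIV (\<lambda>_. count_space UNIV) J (PiE J E)" and J: "finite J"
    by (rule prod_algebraE) auto
  have "emeasure (pca_kernel \<theta> x) A
      = (\<Prod>j\<in>J. ennreal (measure_pmf.prob (bernoulli_pmf (\<theta> (x j) (x (j + 1)))) (E j)))" for x
  proof -
    have "A = prod_emb UNIV (\<lambda>k. measure_pmf (bernoulli_pmf (\<theta> (x k) (x (k + 1))))) J (PiE J E)"
      by (simp add: A prod_emb_def)
    then have "emeasure (pca_kernel \<theta> x) A
        = (\<Prod>j\<in>J. emeasure (measure_pmf (bernoulli_pmf (\<theta> (x j) (x (j + 1))))) (E j))"
      unfolding pca_kernel_def using J
      by (simp only:) (rule emeasure_PiM_emb, auto simp: measure_pmf.prob_space_axioms)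
    then show ?thesis by (simp add: measure_pmf.emeasure_eq_measure)
  qed
  moreover have "(\<lambda>x. x k) \<in> measurable (bernoulli_field p) (count_space UNIV)" for k
    unfolding bernoulli_field_def measurable_cong_sets[OF sets_PiM_bernoulli refl]
    by (rule measurable_component_singleton) simp
  then have "(\<lambda>x. measure_pmf.prob (bernoulli_pmf (\<theta> (x j) (x (j + 1)))) (E j))
      \<in> borel_measurable (bernoulli_field p)" for j
    by (intro measurable_two_bits)
  ultimately show "(\<lambda>x. emeasure (pca_kernel \<theta> x) A) \<in> borel_measurable (bernoulli_field p)"
    by simp
qed

text \<open>
  The image of \<open>\<mu>\<^sub>p\<close> is computed on the atoms of an interval: they only depend on the finitely many
  bits that are parents of this interval, so that the integral is the sum of \<open>sum_row_bernoulli\<close>.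
\<close>

lemma bernoulli_field_invariant:
  assumes stationary: "\<And>x y. (\<Sum>u\<in>UNIV. pmf (bernoulli_pmf p) u * pmf (bernoulli_pmf (\<theta> u x)) y)
      = pmf (bernoulli_pmf p) y"
  shows "pca_invariant \<theta> (bernoulli_field p)"
  unfolding pca_invariant_def
proof (rule measure_eqI_binary_atoms[where I = UNIV])
  let ?P = "PiM UNIV (\<lambda>_. count_space UNIV) :: (int \<Rightarrow> bool) measure"
  let ?\<mu> = "bernoulli_field p"
  interpret \<mu>: prob_space ?\<mu>
    unfolding bernoulli_field_def by (rule prob_space_PiM_bernoulli)
  have sets_\<mu>: "sets ?\<mu> = sets ?P"
    unfolding bernoulli_field_def by (rule sets_PiM_bernoulli)
  then show "sets ?\<mu> = sets ?P" .
  have space_\<mu>: "space ?\<mu> = UNIV" by (simp add: bernoulli_field_def)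
  have sub: "pca_kernel \<theta> \<in> measurable ?\<mu> (subprob_algebra ?P)"
    by (rule measurable_prob_algebraD[OF pca_kernel_measurable])
  show sets_bind: "sets (bind ?\<mu> (pca_kernel \<theta>)) = sets ?P"
    by (rule sets_bind_measurable[OF sub]) (simp add: space_\<mu>)
  have "?\<mu> \<in> space (prob_algebra ?\<mu>)"
    by (simp add: space_prob_algebra \<mu>.prob_space_axioms)
  then show "finite_measure (bind ?\<mu> (pca_kernel \<theta>))"
    by (rule prob_space.finite_measure[OF prob_space_bind'[OF _ pca_kernel_measurable]])
  show "finite_measure ?\<mu>" by (rule \<mu>.finite_measure_axioms)
  fix F :: "int set" assume F: "finite F"
  \<comment> \<open>With \<open>0\<close> inserted, \<open>{b..d}\<close> is a nonempty interval around \<open>F\<close>.\<close>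
  define b d where "b = Min (insert 0 F)" and "d = Max (insert 0 F)"
  have "b \<le> 0" "0 \<le> d" using F by (auto simp: b_def d_def)
  have "measure (bind ?\<mu> (pca_kernel \<theta>)) {x. \<forall>k\<in>{b..d}. x k = \<sigma> k}
      = measure ?\<mu> {x. \<forall>k\<in>{b..d}. x k = \<sigma> k}" for \<sigma>
  proof -
    let ?A = "{x. \<forall>k\<in>{b..d}. x k = \<sigma> k}"
    let ?w = "\<lambda>x. \<Prod>k\<in>{b..d}. pmf (bernoulli_pmf (\<theta> (x k) (x (k + 1)))) (\<sigma> k)"
    have coord: "(\<lambda>x. x k) \<in> measurable ?\<mu> (count_space UNIV)" for k
      unfolding measurable_cong_sets[OF sets_\<mu> refl] by (rule measurable_component_singleton) simp
    have w_cyl: "?w x = ?w y" if "\<And>j. j \<in> {b..d + 1} \<Longrightarrow> x j = y j" for x y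
      using that by (intro prod.cong refl) auto
    note w_int = \<mu>.integral_finite_cylinder[where J = "{b..d + 1}" and Y = "\<lambda>k x. x k" and F = ?w,
        OF finite_atLeastAtMost_int coord w_cyl]
    have "{x \<in> space ?P. \<forall>k\<in>{b..d}. x k \<in> {\<sigma> k}} \<in> sets ?P"
      by (intro sets_binary_atom measurable_component_singleton) auto
    then have "?A \<in> sets ?P" by (simp add: space_PiM)
    then have "emeasure (bind ?\<mu> (pca_kernel \<theta>)) ?A = (\<integral>\<^sup>+x. emeasure (pca_kernel \<theta> x) ?A \<partial>?\<mu>)"
      by (intro emeasure_bind[OF _ sub]) (simp_all add: space_\<mu>)
    also have "\<dots> = (\<integral>\<^sup>+x. ennreal (?w x) \<partial>?\<mu>)"
    proof (rule nn_integral_cong)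
      fix x
      interpret K: prob_space "pca_kernel \<theta> x"
        unfolding pca_kernel_def by (rule prob_space_PiM_bernoulli)
      show "emeasure (pca_kernel \<theta> x) ?A = ennreal (?w x)"
        unfolding K.emeasure_eq_measure unfolding pca_kernel_def
        by (subst measure_PiM_bernoulli_atom) simp_all
    qed
    also have "\<dots> = ennreal (\<integral>x. ?w x \<partial>?\<mu>)"
      by (rule nn_integral_eq_integral[OF w_int(1)]) (auto intro!: prod_nonneg)
    also have "(\<integral>x. ?w x \<partial>?\<mu>)
        = (\<Sum>g\<in>PiE {b..d + 1} (\<lambda>_. UNIV). ?w g * (\<Prod>k\<in>{b..d + 1}. pmf (bernoulli_pmf p) (g k)))"
    proof -
      have "measure ?\<mu> {x \<in> space ?\<mu>. \<forall>j\<in>{b..d + 1}. x j = g j} = (\<Prod>k\<in>{b..d + 1}. pmf (bernoulli_pmf p) (g k))" for g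
        using measure_PiM_bernoulli_atom[of "{b..d + 1}" "\<lambda>_. p" g]
        unfolding space_\<mu> by (simp add: bernoulli_field_def)
      then show ?thesis by (intro trans[OF w_int(2)] sum.cong refl arg_cong2[where f = "(*)"])
    qed
    also have "\<dots> = (\<Prod>k\<in>{b..d}. pmf (bernoulli_pmf p) (\<sigma> k))"
      using sum_row_bernoulli[where \<theta> = \<theta> and p = p and b = b and d = d and \<sigma> = \<sigma>, OF stationary] \<open>b \<le> 0\<close> \<open>0 \<le> d\<close> by (simp add: mult.commute)
    also have "\<dots> = measure ?\<mu> ?A"
      unfolding bernoulli_field_def by (rule measure_PiM_bernoulli_atom[symmetric]) simp
    finally show ?thesis by (simp add: measure_def)
  qed
  moreover have "F \<subseteq> {b..d}" using F by (auto simp: b_def d_def)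
  moreover have "space (bind ?\<mu> (pca_kernel \<theta>)) = UNIV"
    using sets_eq_imp_space_eq[OF sets_bind] by (simp add: space_PiM)
  ultimately show "\<exists>J. finite J \<and> F \<subseteq> J \<and> J \<subseteq> UNIV \<and>
      (\<forall>\<sigma>. measure (bind ?\<mu> (pca_kernel \<theta>)) {x \<in> space (bind ?\<mu> (pca_kernel \<theta>)). \<forall>j\<in>J. x j = \<sigma> j}
        = measure ?\<mu> {x \<in> space ?\<mu>. \<forall>j\<in>J. x j = \<sigma> j})"
    using space_\<mu> by (intro exI[of _ "{b..d}"]) simp
qed

section \<open>The turned diagram\<close>

theorem proposition3p8:
  fixes \<theta> \<phi> :: "bool \<Rightarrow> bool \<Rightarrow> real" and p :: real
  assumes \<theta>_range: "\<And>x y. 0 \<le> \<theta> x y \<and> \<theta> x y \<le> 1"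
    and p_range: "0 < p" "p < 1"
    and inv0: "(1 - p) * \<theta> False False + p * \<theta> True False = p"
    and inv1: "(1 - p) * \<theta> False True + p * \<theta> True True = p"
    and \<phi>: "\<phi> False False = \<theta> False False" "\<phi> True True = \<theta> True True"
           "\<phi> False True = \<theta> True False" "\<phi> True False = \<theta> False True"
  shows "pca_invariant \<theta> (bernoulli_field p) \<and>
    (\<forall>(M :: 'a measure) X. stationary_diagram \<theta> p M X \<longrightarrow>
      (\<forall>c. prob_space.indep_vars M (\<lambda>_. count_space UNIV) (\<lambda>n. X n (c - n)) UNIV \<and>
           (\<forall>n. distr M (count_space UNIV) (X n (c - n)) = measure_pmf (bernoulli_pmf p)) \<and>
           distr M (PiM UNIV (\<lambda>_. count_space UNIV)) (\<lambda>\<omega> n. X n (c - n) \<omega>) = bernoulli_field p) \<and>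
      (let Z = (\<lambda>m j. X j (- m - j)) in
        stationary_diagram \<phi> p M Z \<and>
        (\<forall>(N :: 'b measure) Y. stationary_diagram \<phi> p N Y \<longrightarrow> field_law M Z = field_law N Y)) \<and>
      (\<forall>c. let line = generated_algebra M UNIV (\<lambda>n. X n (c + 1 - n)) in
        cond_indep_vars M line (\<lambda>n. X n (c - n)) UNIV \<and>
        (\<forall>n. AE \<omega> in M. cprob M line (X n (c - n)) \<omega>
               = \<phi> (X n (c - n + 1) \<omega>) (X (n + 1) (c - n) \<omega>))))"
proof (intro conjI allI impI)
  have transposed: "\<phi> x y = \<theta> y x" for x y
    using \<phi> by (cases x; cases y) simp_all
  then have \<phi>_range: "0 \<le> \<phi> x y \<and> \<phi> x y \<le> 1" for x y
    using \<theta>_range by simp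
  have inv: "(1 - p) * \<theta> False x + p * \<theta> True x = p" for x
    using inv0 inv1 by (cases x) simp_all
  note balance = bernoulli_rule_balance[where \<theta> = \<theta> and \<phi> = \<phi>, OF \<theta>_range p_range[THEN less_imp_le] inv transposed]
  have "(\<Sum>u\<in>UNIV. pmf (bernoulli_pmf p) u * pmf (bernoulli_pmf (\<theta> u x)) y) = pmf (bernoulli_pmf p) y" for x y
    unfolding balance sum_distrib_left[symmetric] by (simp add: sum_pmf_eq_1)
  then show "pca_invariant \<theta> (bernoulli_field p)"
    by (rule bernoulli_field_invariant)
  fix M :: "'a measure" and X
  assume diagram: "stationary_diagram \<theta> p M X"
  then have M: "prob_space M" and X: "X n k \<in> measurable M (count_space UNIV)" for n k
    by (auto simp: stationary_diagram_def)
  define Z where "Z = (\<lambda>m j. X j (- m - j))"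
  have Z: "Z m j \<in> measurable M (count_space UNIV)" for m j
    unfolding Z_def by (rule X)
  have Z_law: "triangle_law \<phi> p M Z"
    unfolding Z_def
    by (rule triangle_law_rotate[where \<theta> = \<theta> and \<phi> = \<phi>, OF balance stationary_diagram_triangle_law[OF \<theta>_range diagram]])
  have Z_diagram: "stationary_diagram \<phi> p M Z"
    by (rule triangle_law_stationary_diagram[OF M Z Z_law \<phi>_range])
  {
    fix c
    \<comment> \<open>The line \<open>n + k = c\<close> is row \<open>- c\<close> of the turned diagram, and its predecessor is the line \<open>n + k = c + 1\<close>.\<close>
    have law: "distr M (PiM UNIV (\<lambda>_. count_space UNIV)) (\<lambda>\<omega> n. X n (c - n) \<omega>) = bernoulli_field p"
      using triangle_law_row[OF M Z Z_law, of "- c"] by (simp add: Z_def)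
    show "distr M (PiM UNIV (\<lambda>_. count_space UNIV)) (\<lambda>\<omega> n. X n (c - n) \<omega>) = bernoulli_field p"
      by (rule law)
    show "prob_space.indep_vars M (\<lambda>_. count_space UNIV) (\<lambda>n. X n (c - n)) UNIV"
      and "distr M (count_space UNIV) (X n (c - n)) = measure_pmf (bernoulli_pmf p)" for n
      using prob_space.bernoulli_field_iid[OF M X law] by blast+
    let ?line = "generated_algebra M UNIV (\<lambda>n. X n (c + 1 - n))"
    have "cond_indep_vars M ?line (Z (- (c + 1) + 1)) UNIV \<and>
        (\<forall>n. AE \<omega> in M. cprob M ?line (Z (- (c + 1) + 1) n) \<omega>
          = \<phi> (Z (- (c + 1)) n \<omega>) (Z (- (c + 1)) (n + 1) \<omega>))"
    proof (rule triangle_law_conditional[OF M Z Z_law \<phi>_range space_generated_algebra])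
      show "sets ?line \<subseteq> sets (past M Z (- (c + 1)))"
      proof (rule sets_generated_algebra_mono)
        fix n
        show "\<exists>s\<in>{..- (c + 1)} \<times> UNIV. X n (c + 1 - n) = (\<lambda>(m, j). Z m j) s"
          by (intro bexI[of _ "(- (c + 1), n)"]) (simp_all add: Z_def add.commute)
      qed
      show "Z (- (c + 1)) n \<in> measurable ?line (count_space UNIV)" for n
        using measurable_generated_algebra[of n UNIV "\<lambda>n. X n (c + 1 - n)" M] by (simp add: Z_def add.commute)
    qed
    moreover have "Z (- (c + 1) + 1) n = X n (c - n)" "Z (- (c + 1)) n = X n (c - n + 1)"
      "Z (- (c + 1)) (n + 1) = X (n + 1) (c - n)" for n
      by (simp_all add: Z_def algebra_simps)
    moreover have "Z (- (c + 1) + 1) = (\<lambda>n. X n (c - n))"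
      by (simp add: Z_def algebra_simps)
    ultimately show "let line = ?line in
        cond_indep_vars M line (\<lambda>n. X n (c - n)) UNIV \<and>
        (\<forall>n. AE \<omega> in M. cprob M line (X n (c - n)) \<omega>
               = \<phi> (X n (c - n + 1) \<omega>) (X (n + 1) (c - n) \<omega>))"
      by (simp add: Let_def)
  }
  have "field_law M Z = field_law N Y" if "stationary_diagram \<phi> p N Y" for N :: "'b measure" and Y
    using that triangle_law_unique[OF M Z _ _ Z_law stationary_diagram_triangle_law[OF \<phi>_range that]]
    by (simp add: stationary_diagram_def)
  with Z_diagram show "let Z = (\<lambda>m j. X j (- m - j)) in
      stationary_diagram \<phi> p M Z \<and>
      (\<forall>(N :: 'b measure) Y. stationary_diagram \<phi> p N Y \<longrightarrow> field_law M Z = field_law N Y)"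
    by (simp add: Let_def Z_def)
qed

end
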